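(* Let $\mathfrak{A}\subset\mathcal{B}(H)$ be a dual algebra on a Hilbert space $H$ with property $\mathbb{A}_1(1)$, and let $\mathfrak{J}$ be any ideal of $\mathfrak{A}$ that is closed in the weak operator topology. Then for every $A\in\mathfrak{A}$, \[ \operatorname{dist}(A,\mathfrak{J}) = \sup_{L\in\operatorname{CycLat}(\mathfrak{A})} \big\| P_{L\ominus \mathfrak{J}L}\, A^*|_{L\ominus\mathfrak{J}L}\big\| . \]
   Context: A dual algebra on $H$ is a unital subalgebra of $\mathcal{B}(H)$ (containing $I$) that is closed in the weak-$*$ topology of $\mathcal{B}(H)$. "Ideal" means two-sided ideal. A dual algebra $\mathfrak{A}$ has property $\mathbb{A}_1(1)$ if for every weak-$*$ continuous linear functional $\varphi$ on $\mathfrak{A}$ with $\|\varphi\|<1$ there are $x,y\in H$ with $\|x\|\,\|y\|<1$ and $\varphi(A)=\langle Ax,y\rangle$ for all $A\in\mathfrak{A}$. $\operatorname{CycLat}(\mathfrak{A})$ is the set of cyclic invariant subspaces $\mathfrak{A}[h]=\overline{\{Ah: A\in\mathfrak{A}\}}$, $h\in H$. For a subspace $L$, $L\ominus\mathfrak{J}L$ is the set of vectors of $L$ orthogonal to $\{Bx : B\in\mathfrak{J}, x\in L\}$, and $P_N$ denotes the orthogonal projection of $H$ onto a closed subspace $N$. $\operatorname{dist}(A,\mathfrak{J})=\inf_{B\in\mathfrak{J}}\|A-B\|$. *)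

theory Defs
  imports "HOL-Analysis.Analysis"
begin

section \<open>Complex Hilbert spaces\<close>

text \<open>The inner product is linear in its first argument. Completeness comes from \<^class>\<open>banach\<close>.\<close>

class complex_hilbert = banach +
  fixes scaleC :: "complex \<Rightarrow> 'a \<Rightarrow> 'a"  (infixr "*\<^sub>C" 75)
    and cinner :: "'a \<Rightarrow> 'a \<Rightarrow> complex"
  assumes scaleC_add_right: "c *\<^sub>C (x + y) = c *\<^sub>C x + c *\<^sub>C y"
    and scaleC_add_left: "(c + d) *\<^sub>C x = c *\<^sub>C x + d *\<^sub>C x"
    and scaleC_scaleC: "c *\<^sub>C d *\<^sub>C x = (c * d) *\<^sub>C x"
    and scaleR_scaleC: "r *\<^sub>R x = complex_of_real r *\<^sub>C x"
    and cinner_commute: "cinner x y = cnj (cinner y x)"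
    and cinner_add_left: "cinner (x + y) z = cinner x z + cinner y z"
    and cinner_scaleC_left: "cinner (c *\<^sub>C x) y = c * cinner x y"
    and cinner_ge_zero: "0 \<le> Re (cinner x x)"
    and cinner_eq_zero_iff: "cinner x x = 0 \<longleftrightarrow> x = 0"
    and norm_eq_sqrt_cinner: "norm x = sqrt (Re (cinner x x))"

instantiation complex :: complex_hilbert
begin

definition "scaleC_complex (c::complex) (x::complex) = c * x"
definition "cinner_complex (x::complex) (y::complex) = x * cnj y"

instance
  by standard
    (auto simp: scaleC_complex_def cinner_complex_def algebra_simps scaleR_conv_of_real
      cmod_def power2_eq_square)

end

lemma norm_scaleC:
  fixes x :: "'a::complex_hilbert"
  shows "norm (c *\<^sub>C x) = cmod c * norm x"
proof -
  have "cinner (c *\<^sub>C x) (c *\<^sub>C x) = c * cinner x (c *\<^sub>C x)"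
    by (simp add: cinner_scaleC_left)
  also have "cinner x (c *\<^sub>C x) = cnj c * cinner x x"
    by (subst (1 2) cinner_commute) (simp add: cinner_scaleC_left)
  finally have "cinner (c *\<^sub>C x) (c *\<^sub>C x) = complex_of_real ((cmod c)\<^sup>2) * cinner x x"
    by (simp only: complex_norm_square mult.assoc)
  then have "Re (cinner (c *\<^sub>C x) (c *\<^sub>C x)) = (cmod c)\<^sup>2 * Re (cinner x x)"
    by simp
  then show ?thesis
    by (simp add: norm_eq_sqrt_cinner[where 'a='a] real_sqrt_mult)
qed

lemma bounded_linear_scaleC: "bounded_linear (\<lambda>x::'a::complex_hilbert. c *\<^sub>C x)"
  by (rule bounded_linear_intro[where K = "cmod c"])
    (simp_all add: scaleC_add_right scaleR_scaleC scaleC_scaleC norm_scaleC mult.commute)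


section \<open>Operators\<close>

text \<open>The type \<open>'a \<Rightarrow>\<^sub>L 'a\<close> consists of the bounded real-linear maps, so $\mathcal B(H)$ is the set
  of its complex-linear elements; its norm is the operator norm.\<close>

definition bounded_ops :: "('h::complex_hilbert \<Rightarrow>\<^sub>L 'h) set" where
  "bounded_ops = {A. \<forall>c x. blinfun_apply A (c *\<^sub>C x) = c *\<^sub>C blinfun_apply A x}"

lift_definition scale_op :: "complex \<Rightarrow> ('h::complex_hilbert \<Rightarrow>\<^sub>L 'h) \<Rightarrow> 'h \<Rightarrow>\<^sub>L 'h"
  is "\<lambda>c A x. c *\<^sub>C A x"
  by (rule bounded_linear_compose[OF bounded_linear_scaleC])

definition adj_op :: "('h::complex_hilbert \<Rightarrow>\<^sub>L 'h) \<Rightarrow> 'h \<Rightarrow>\<^sub>L 'h" where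
  "adj_op A = (THE B. \<forall>x y. cinner (blinfun_apply A x) y = cinner x (blinfun_apply B y))"

definition ortho_proj :: "'h::complex_hilbert set \<Rightarrow> 'h \<Rightarrow> 'h" where
  "ortho_proj N x = (THE y. y \<in> N \<and> (\<forall>z\<in>N. cinner (x - y) z = 0))"

text \<open>The operator norm of the restriction of \<open>f\<close> to a subspace \<open>N\<close>, after \<^const>\<open>onorm\<close>
  (the vector \<open>0\<close> contributes \<open>0 / 0 = 0\<close>).\<close>

definition onorm_on :: "'a::real_normed_vector set \<Rightarrow> ('a \<Rightarrow> 'b::real_normed_vector) \<Rightarrow> real" where
  "onorm_on N f = (SUP x\<in>N. norm (f x) / norm x)"


section \<open>The weak operator and the weak-* topology\<close>

definition weak_operator_topology :: "('h::complex_hilbert \<Rightarrow>\<^sub>L 'h) topology" where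
  "weak_operator_topology = topology_generated_by
     {{A \<in> bounded_ops. cinner (blinfun_apply A x) y \<in> U} | x y U. open U}"

definition orthonormal_basis :: "'h::complex_hilbert set \<Rightarrow> bool" where
  "orthonormal_basis E \<longleftrightarrow>
     (\<forall>e\<in>E. \<forall>f\<in>E. cinner e f = (if e = f then 1 else 0)) \<and>
     (\<forall>x. (\<forall>e\<in>E. cinner x e = 0) \<longrightarrow> x = 0)"

text \<open>Trace and trace class do not depend on the orthonormal basis, so one is chosen.\<close>

definition some_onb :: "'h::complex_hilbert set" where
  "some_onb = (SOME E. orthonormal_basis E)"

definition positive_op :: "('h::complex_hilbert \<Rightarrow>\<^sub>L 'h) \<Rightarrow> bool" where
  "positive_op S \<longleftrightarrow> S \<in> bounded_ops \<and>
     (\<forall>x. cinner (blinfun_apply S x) x \<in> \<real> \<and> 0 \<le> Re (cinner (blinfun_apply S x) x))"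

text \<open>In the next definition \<open>S\<close> is $|T| = (T^*T)^{1/2}$, the unique positive square root.\<close>

definition trace_class :: "('h::complex_hilbert \<Rightarrow>\<^sub>L 'h) set" where
  "trace_class = {T \<in> bounded_ops. \<exists>S. positive_op S \<and> S o\<^sub>L S = adj_op T o\<^sub>L T \<and>
     (\<lambda>e. cinner (blinfun_apply S e) e) summable_on some_onb}"

definition op_trace :: "('h::complex_hilbert \<Rightarrow>\<^sub>L 'h) \<Rightarrow> complex" where
  "op_trace T = (\<Sum>\<^sub>\<infinity>e\<in>some_onb. cinner (blinfun_apply T e) e)"

text \<open>$\mathcal B(H)$ is the dual of the trace class under the pairing $(A, T) \mapsto
  \mathrm{tr}(AT)$.\<close>

definition weak_star_topology :: "('h::complex_hilbert \<Rightarrow>\<^sub>L 'h) topology" where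
  "weak_star_topology = topology_generated_by
     {{A \<in> bounded_ops. op_trace (A o\<^sub>L T) \<in> U} | T U. T \<in> trace_class \<and> open U}"


section \<open>Dual algebras\<close>

definition op_subspace :: "('h::complex_hilbert \<Rightarrow>\<^sub>L 'h) set \<Rightarrow> bool" where
  "op_subspace M \<longleftrightarrow> M \<subseteq> bounded_ops \<and> 0 \<in> M \<and>
     (\<forall>A\<in>M. \<forall>B\<in>M. A + B \<in> M) \<and> (\<forall>c. \<forall>A\<in>M. scale_op c A \<in> M)"

definition dual_algebra :: "('h::complex_hilbert \<Rightarrow>\<^sub>L 'h) set \<Rightarrow> bool" where
  "dual_algebra \<AA> \<longleftrightarrow> op_subspace \<AA> \<and> id_blinfun \<in> \<AA> \<and>
     (\<forall>A\<in>\<AA>. \<forall>B\<in>\<AA>. A o\<^sub>L B \<in> \<AA>) \<and> closedin weak_star_topology \<AA>"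

definition two_sided_ideal :: "('h::complex_hilbert \<Rightarrow>\<^sub>L 'h) set \<Rightarrow> ('h \<Rightarrow>\<^sub>L 'h) set \<Rightarrow> bool" where
  "two_sided_ideal \<JJ> \<AA> \<longleftrightarrow> op_subspace \<JJ> \<and> \<JJ> \<subseteq> \<AA> \<and>
     (\<forall>A\<in>\<AA>. \<forall>B\<in>\<JJ>. A o\<^sub>L B \<in> \<JJ> \<and> B o\<^sub>L A \<in> \<JJ>)"

text \<open>Only the values of \<open>\<phi>\<close> on \<open>\<AA>\<close> matter.\<close>

definition weak_star_functional ::
    "('h::complex_hilbert \<Rightarrow>\<^sub>L 'h) set \<Rightarrow> (('h \<Rightarrow>\<^sub>L 'h) \<Rightarrow> complex) \<Rightarrow> bool" where
  "weak_star_functional \<AA> \<phi> \<longleftrightarrow>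
     (\<forall>A\<in>\<AA>. \<forall>B\<in>\<AA>. \<phi> (A + B) = \<phi> A + \<phi> B) \<and>
     (\<forall>c. \<forall>A\<in>\<AA>. \<phi> (scale_op c A) = c * \<phi> A) \<and>
     continuous_map (subtopology weak_star_topology \<AA>) euclidean \<phi>"

definition property_A1_1 :: "('h::complex_hilbert \<Rightarrow>\<^sub>L 'h) set \<Rightarrow> bool" where
  "property_A1_1 \<AA> \<longleftrightarrow>
     (\<forall>\<phi>. weak_star_functional \<AA> \<phi> \<and> onorm_on \<AA> \<phi> < 1 \<longrightarrow>
       (\<exists>x y. norm x * norm y < 1 \<and> (\<forall>A\<in>\<AA>. \<phi> A = cinner (blinfun_apply A x) y)))"

definition CycLat :: "('h::complex_hilbert \<Rightarrow>\<^sub>L 'h) set \<Rightarrow> 'h set set" where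
  "CycLat \<AA> = {closure {blinfun_apply A h | A. A \<in> \<AA>} | h. True}"

text \<open>\<open>ominus_ideal L \<JJ>\<close> is $L \ominus \mathfrak J L$.\<close>

definition ominus_ideal :: "'h::complex_hilbert set \<Rightarrow> ('h \<Rightarrow>\<^sub>L 'h) set \<Rightarrow> 'h set" where
  "ominus_ideal L \<JJ> = {v \<in> L. \<forall>B\<in>\<JJ>. \<forall>x\<in>L. cinner v (blinfun_apply B x) = 0}"

end

theory Submission
  imports Defs
begin

text \<open>The inequality \<open>\<ge>\<close> is elementary. If \<open>u, w\<close> lie in \<open>N = L \<ominus> \<JJ>L\<close>, then \<open>\<langle>A\<^sup>* u, w\<rangle> = \<langle>u, A w\<rangle>\<close>
  does not change when \<open>A\<close> is replaced by \<open>A - B\<close> with \<open>B \<in> \<JJ>\<close>, because \<open>B w\<close> lies in \<open>\<JJ>L\<close>; so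
  the compression of \<open>A\<^sup>*\<close> to \<open>N\<close> has norm at most the distance
  (\<open>compression_norm_le_infdist\<close>).

  For \<open>\<le>\<close>, let \<open>r\<close> be positive and smaller than the distance. Then \<open>A\<close> is separated from \<open>\<JJ>\<close> by a
  functional \<open>\<phi>\<close> that vanishes on \<open>\<JJ>\<close>, has norm less than 1 and satisfies \<open>Re (\<phi> A) = r\<close>
  (\<open>distance_functional\<close>). The proof does not pass through a general Hahn-Banach theorem: the ball
  of radius \<open>r\<close> around \<open>A\<close> is compact in the weak operator topology and misses the closed set \<open>\<JJ>\<close>,
  so finitely many matrix entries \<open>\<langle>S x\<^sub>i, y\<^sub>i\<rangle>\<close> already tell the two sets apart by a fixed margin,
  and the separation takes place in \<open>\<complex>\<^sup>n\<close>. The functional is therefore a finite combination of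
  matrix entries. It is weak-* continuous since each matrix entry is the trace pairing with an
  operator of rank one, by Parseval's identity.

  Property \<open>A\<^sub>1(1)\<close> now gives \<open>\<phi> S = \<langle>S x, y\<rangle>\<close> on the algebra, with \<open>\<parallel>x\<parallel> \<parallel>y\<parallel> < 1\<close>. Let \<open>L\<close> be the
  cyclic subspace of \<open>x\<close> and \<open>v\<close> the projection of \<open>y\<close> to \<open>L\<close>. Since \<open>\<JJ>\<close> is an ideal on which \<open>\<phi>\<close>
  vanishes, \<open>v\<close> belongs to \<open>N\<close>. Moreover \<open>P\<^sub>L A\<^sup>* v = P\<^sub>N A\<^sup>* v\<close>, as \<open>\<JJ>L\<close> is invariant under \<open>A\<close>, so
  \<open>\<phi> A = \<langle>x, A\<^sup>* v\<rangle> = \<langle>x, P\<^sub>N A\<^sup>* v\<rangle>\<close> and \<open>r \<le> \<bar>\<phi> A\<bar>\<close> is bounded by the norm of the compression,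
  because \<open>\<parallel>x\<parallel> \<parallel>v\<parallel> < 1\<close> (\<open>vector_functional_via_compression\<close>).\<close>

section \<open>Inner products, projections and adjoints\<close>

lemma cinner_add_right:
  fixes x y z :: "'h::complex_hilbert"
  shows "cinner x (y + z) = cinner x y + cinner x z"
  by (metis cinner_add_left cinner_commute complex_cnj_add)

lemma cinner_scaleC_right:
  fixes x y :: "'h::complex_hilbert"
  shows "cinner x (c *\<^sub>C y) = cnj c * cinner x y"
  by (metis cinner_commute cinner_scaleC_left complex_cnj_mult)

lemma cinner_self:
  fixes x :: "'h::complex_hilbert"
  shows "cinner x x = complex_of_real ((norm x)\<^sup>2)"
proof -
  have "Im (cinner x x) = 0"
    using cinner_commute[of x x] by (metis Reals_cnj_iff complex_is_Real_iff)
  moreover have "(norm x)\<^sup>2 = Re (cinner x x)"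
    by (simp add: norm_eq_sqrt_cinner cinner_ge_zero)
  ultimately show ?thesis
    by (simp add: complex_eq_iff)
qed

lemma scaleC_one: "1 *\<^sub>C (x::'h::complex_hilbert) = x"
  using scaleR_scaleC[of 1 x] by simp

lemma scaleC_zero_left: "0 *\<^sub>C (x::'h::complex_hilbert) = 0"
  using scaleR_scaleC[of 0 x] by simp

lemma norm_add_sq:
  fixes x y :: "'h::complex_hilbert"
  shows "(norm (x + y))\<^sup>2 = (norm x)\<^sup>2 + (norm y)\<^sup>2 + 2 * Re (cinner x y)"
proof -
  have "complex_of_real ((norm (x + y))\<^sup>2)
      = complex_of_real ((norm x)\<^sup>2) + complex_of_real ((norm y)\<^sup>2)
        + (cinner x y + cnj (cinner x y))"
    unfolding cinner_self[symmetric]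
    using cinner_commute[of y x]
    by (simp add: cinner_add_left cinner_add_right algebra_simps)
  then have "Re (complex_of_real ((norm (x + y))\<^sup>2))
      = Re (complex_of_real ((norm x)\<^sup>2) + complex_of_real ((norm y)\<^sup>2)
        + (cinner x y + cnj (cinner x y)))"
    by simp
  then show ?thesis
    by simp
qed

lemma cauchy_schwarz:
  fixes x y :: "'h::complex_hilbert"
  shows "cmod (cinner x y) \<le> norm x * norm y"
proof (cases "y = 0")
  case True
  have "cinner x 0 = 0"
    using cinner_scaleC_right[of x 0 0] by (simp add: scaleC_zero_left)
  then show ?thesis
    using True by simp
next
  case False
  define d where "d = cinner x y"
  define n where "n = (norm y)\<^sup>2"
  have n: "n > 0"
    using False by (simp add: n_def)
  \<comment> \<open>\<open>x + c y\<close> is the component of \<open>x\<close> orthogonal to \<open>y\<close>.\<close>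
  define c where "c = - d / complex_of_real n"
  have cd: "(cmod c)\<^sup>2 * n = (cmod d)\<^sup>2 / n"
    using n by (simp add: c_def norm_divide power2_eq_square)
  have "cnj c * d = - complex_of_real ((cmod d)\<^sup>2 / n)"
    using complex_norm_square[of d] by (simp add: c_def mult.commute)
  then have re: "Re (cnj c * d) = - (cmod d)\<^sup>2 / n"
    by (metis Re_complex_of_real minus_divide_left of_real_minus)
  have "0 \<le> (norm (x + c *\<^sub>C y))\<^sup>2"
    by simp
  also have "\<dots> = (norm x)\<^sup>2 + (cmod c)\<^sup>2 * n + 2 * Re (cnj c * d)"
    by (simp add: norm_add_sq norm_scaleC cinner_scaleC_right d_def n_def power_mult_distrib)
  also have "\<dots> = (norm x)\<^sup>2 - (cmod d)\<^sup>2 / n"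
    unfolding cd re by simp
  finally have "(cmod d)\<^sup>2 / n \<le> (norm x)\<^sup>2"
    by simp
  then have "(cmod d)\<^sup>2 \<le> (norm x * norm y)\<^sup>2"
    using n by (simp add: divide_le_eq n_def power_mult_distrib)
  then show ?thesis
    unfolding d_def by (rule power2_le_imp_le) simp
qed

interpretation cinner: bounded_bilinear "cinner :: 'h::complex_hilbert \<Rightarrow> 'h \<Rightarrow> complex"
proof
  show "\<exists>K. \<forall>a b::'h. cmod (cinner a b) \<le> norm a * norm b * K"
    by (intro exI[of _ 1]) (simp add: cauchy_schwarz)
qed (simp_all add: cinner_add_left cinner_add_right scaleR_scaleC cinner_scaleC_left
    cinner_scaleC_right scaleC_complex_def)

lemma cinner_eqI:
  fixes x y :: "'h::complex_hilbert"
  assumes "\<And>z. cinner x z = cinner y z"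
  shows "x = y"
  using assms[of "x - y"] cinner_eq_zero_iff[of "x - y"]
  by (simp add: cinner.diff_left)

text \<open>The parallelogram law is what makes a norm-minimising sequence in a convex set Cauchy. It
  is stated for the square \<open>q\<close> of an arbitrary Hilbert seminorm, because it is needed both for
  the norm of a Hilbert space and for seminorms on operators that see only finitely many matrix
  entries.\<close>

lemma minimising_sequence:
  fixes q :: "'v::real_vector \<Rightarrow> real"
  assumes parallelogram: "\<And>u v. q (u + v) + q (u - v) = 2 * q u + 2 * q v"
    and homogeneous: "\<And>r u. q (r *\<^sub>R u) = r\<^sup>2 * q u"
    and nonneg: "\<And>u. 0 \<le> q u"
    and C: "convex C" "C \<noteq> {}"
  shows "\<exists>X. (\<forall>n. X n \<in> C) \<and> (\<lambda>n. q (X n)) \<longlonglongrightarrow> Inf (q ` C) \<and>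
    (\<forall>e>0. \<exists>M. \<forall>m\<ge>M. \<forall>n\<ge>M. q (X m - X n) < e)"
proof -
  define Q where "Q = Inf (q ` C)"
  have bdd: "bdd_below (q ` C)"
    using nonneg by (meson bdd_belowI2)
  have Q: "Q \<le> q c" if "c \<in> C" for c
    unfolding Q_def using bdd that by (simp add: cInf_lower)
  have "\<exists>c\<in>C. q c < Q + inverse (real (Suc n))" for n
    using cInf_less_iff[of "q ` C" "Q + inverse (real (Suc n))"] C(2) bdd
    unfolding Q_def by (auto simp: add_pos_pos)
  then obtain X where X: "\<And>n. X n \<in> C" "\<And>n. q (X n) < Q + inverse (real (Suc n))"
    by metis
  have lim: "(\<lambda>n. q (X n)) \<longlonglongrightarrow> Q"
  proof (rule real_tendsto_sandwich[where f = "\<lambda>_. Q" and h = "\<lambda>n. Q + inverse (real (Suc n))"])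
    show "(\<lambda>n. Q + inverse (real (Suc n))) \<longlonglongrightarrow> Q"
      by (rule LIMSEQ_inverse_real_of_nat_add)
    show "\<forall>\<^sub>F n in sequentially. Q \<le> q (X n)"
      using X(1) Q by simp
    show "\<forall>\<^sub>F n in sequentially. q (X n) \<le> Q + inverse (real (Suc n))"
      using X(2) by (meson always_eventually less_imp_le)
  qed simp
  have "\<exists>M. \<forall>m\<ge>M. \<forall>n\<ge>M. q (X m - X n) < e" if "e > 0" for e
  proof -
    have "eventually (\<lambda>n. q (X n) < Q + e / 4) sequentially"
      using lim by (rule order_tendstoD) (use that in simp)
    then obtain M where M: "\<And>n. n \<ge> M \<Longrightarrow> q (X n) < Q + e / 4"
      by (auto simp: eventually_sequentially)
    have "q (X m - X n) < e" if "m \<ge> M" "n \<ge> M" for m n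
    proof -
      have "(1/2) *\<^sub>R X m + (1/2) *\<^sub>R X n \<in> C"
        using convexD[OF C(1) X(1) X(1), of "1/2" "1/2" m n] by simp
      then have "Q \<le> q ((1/2) *\<^sub>R (X m + X n))"
        using Q by (simp add: scaleR_add_right)
      then have "4 * Q \<le> q (X m + X n)"
        by (simp add: homogeneous power2_eq_square)
      then show ?thesis
        using parallelogram[of "X m" "X n"] M[OF that(1)] M[OF that(2)] by linarith
    qed
    then show ?thesis
      by blast
  qed
  then show ?thesis
    using X(1) lim unfolding Q_def by blast
qed

lemma quadratic_nonneg_imp_linear_nonneg:
  fixes a w :: real
  assumes "\<And>t. 0 < t \<Longrightarrow> t \<le> 1 \<Longrightarrow> 0 \<le> 2 * t * a + t\<^sup>2 * w"
  shows "0 \<le> a"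
proof (rule ccontr)
  assume "\<not> 0 \<le> a"
  \<comment> \<open>Small enough for the linear term to dominate: \<open>t \<bar>w\<bar> \<le> - a\<close>.\<close>
  define t where "t = min 1 (- a / (\<bar>w\<bar> + 1))"
  have t: "0 < t" "t \<le> 1"
    using \<open>\<not> 0 \<le> a\<close> by (auto simp: t_def field_simps)
  have "t * (\<bar>w\<bar> + 1) \<le> - a"
    unfolding t_def by (metis (no_types) abs_ge_zero add_nonneg_pos le_divide_eq min.cobounded2
        zero_less_one)
  moreover have "t * w \<le> t * (\<bar>w\<bar> + 1)"
    using t by (intro mult_left_mono) auto
  ultimately have "2 * a + t * w < 0"
    using \<open>\<not> 0 \<le> a\<close> by linarith
  then have "t * (2 * a + t * w) < 0"
    using t by (simp add: mult_pos_neg)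
  then show False
    using assms[OF t] by (simp add: algebra_simps power2_eq_square)
qed

lemma closest_point_exists:
  fixes C :: "'h::complex_hilbert set"
  assumes "closed C" "convex C" "C \<noteq> {}"
  obtains z where "z \<in> C" and "\<And>c. c \<in> C \<Longrightarrow> 0 \<le> Re (cinner z (c - z))"
proof -
  let ?q = "\<lambda>u::'h. (norm u)\<^sup>2"
  have par: "?q (u + v) + ?q (u - v) = 2 * ?q u + 2 * ?q v" for u v :: 'h
    using norm_add_sq[of u v] norm_add_sq[of u "- v"] by (simp add: cinner.minus_right)
  have "\<exists>X. (\<forall>n. X n \<in> C) \<and> (\<lambda>n. ?q (X n)) \<longlonglongrightarrow> Inf (?q ` C) \<and>
      (\<forall>e>0. \<exists>M. \<forall>m\<ge>M. \<forall>n\<ge>M. ?q (X m - X n) < e)"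
    by (rule minimising_sequence[OF par _ _ assms(2,3)]) (simp_all add: power_mult_distrib)
  then obtain X where X: "\<And>n. X n \<in> C" "(\<lambda>n. ?q (X n)) \<longlonglongrightarrow> Inf (?q ` C)"
    "\<And>e. e > 0 \<Longrightarrow> \<exists>M. \<forall>m\<ge>M. \<forall>n\<ge>M. ?q (X m - X n) < e"
    by blast
  have "Cauchy X"
  proof (rule CauchyI)
    fix e :: real
    assume "0 < e"
    then have "\<exists>M. \<forall>m\<ge>M. \<forall>n\<ge>M. ?q (X m - X n) < e\<^sup>2"
      using X(3) by simp
    then show "\<exists>M. \<forall>m\<ge>M. \<forall>n\<ge>M. norm (X m - X n) < e"
      using \<open>0 < e\<close> by (meson less_imp_le power2_less_imp_less)
  qed
  then obtain z where z: "X \<longlonglongrightarrow> z"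
    using Cauchy_convergent_iff convergent_def by blast
  have "z \<in> C"
    using closed_sequentially[OF assms(1)] X(1) z by blast
  have "(\<lambda>n. ?q (X n)) \<longlonglongrightarrow> ?q z"
    by (intro tendsto_intros z)
  then have "?q z = Inf (?q ` C)"
    using X(2) LIMSEQ_unique by blast
  then have min: "?q z \<le> ?q c" if "c \<in> C" for c
    using that by (auto intro!: cInf_lower bdd_belowI2[where m = 0])
  have "0 \<le> Re (cinner z (c - z))" if "c \<in> C" for c
  proof (rule quadratic_nonneg_imp_linear_nonneg)
    fix t :: real
    assume "0 < t" "t \<le> 1"
    then have "z + t *\<^sub>R (c - z) \<in> C"
      using convexD_alt[OF assms(2) \<open>z \<in> C\<close> that, of t] by (simp add: algebra_simps)
    from min[OF this] show "0 \<le> 2 * t * Re (cinner z (c - z)) + t\<^sup>2 * (norm (c - z))\<^sup>2"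
      by (simp add: norm_add_sq cinner.scaleR_right power_mult_distrib)
  qed
  with \<open>z \<in> C\<close> that show ?thesis
    by blast
qed

definition complex_subspace :: "'h::complex_hilbert set \<Rightarrow> bool" where
  "complex_subspace N \<longleftrightarrow> 0 \<in> N \<and> (\<forall>x\<in>N. \<forall>y\<in>N. x + y \<in> N) \<and> (\<forall>c. \<forall>x\<in>N. c *\<^sub>C x \<in> N)"

lemma complex_subspace_imp_subspace: "complex_subspace N \<Longrightarrow> subspace N"
  by (simp add: complex_subspace_def subspace_def scaleR_scaleC)

lemma complex_subspace_closure:
  assumes "complex_subspace N"
  shows "complex_subspace (closure N)"
proof -
  have "x + y \<in> closure N" if "x \<in> closure N" "y \<in> closure N" for x y
  proof -
    have "x + y \<in> closure {a + b | a b. a \<in> N \<and> b \<in> N}"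
    proof -
      have "{a + b | a b. a \<in> N \<and> b \<in> N} = N + N"
        by (auto simp: set_plus_def)
      then show ?thesis
        using that closure_sum[of N N] set_plus_intro by fastforce
    qed
    moreover have "{a + b | a b. a \<in> N \<and> b \<in> N} \<subseteq> N"
      using assms by (auto simp: complex_subspace_def)
    ultimately show ?thesis
      using closure_mono by blast
  qed
  moreover have "c *\<^sub>C x \<in> closure N" if "x \<in> closure N" for c x
  proof -
    have "(\<lambda>x. c *\<^sub>C x) ` closure N \<subseteq> closure N"
      using assms
      by (intro image_closure_subset)
        (auto simp: complex_subspace_def linear_continuous_on bounded_linear_scaleC
          intro: closure_subset[THEN subsetD])
    then show ?thesis
      using that by blast
  qed
  moreover have "0 \<in> closure N"
    using assms closure_subset by (auto simp: complex_subspace_def)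
  ultimately show ?thesis
    by (simp add: complex_subspace_def)
qed

lemma complex_eq_zero_by_rotation:
  assumes "\<And>c. 0 \<le> Re (c * w)"
  shows "w = 0"
  using assms[of 1] assms[of "- 1"] assms[of \<i>] assms[of "- \<i>"]
  by (simp add: complex_eq_iff)

lemma ortho_proj:
  fixes N :: "'h::complex_hilbert set"
  assumes "closed N" "complex_subspace N"
  shows "ortho_proj N x \<in> N" and "z \<in> N \<Longrightarrow> cinner (x - ortho_proj N x) z = 0"
proof -
  have sub: "subspace N"
    by (rule complex_subspace_imp_subspace[OF assms(2)])
  have ex: "\<exists>y. y \<in> N \<and> (\<forall>z\<in>N. cinner (x - y) z = 0)"
  proof -
    have "(\<lambda>y. x - y) ` N \<noteq> {}"
      using sub subspace_0 by blast
    moreover have "convex ((\<lambda>y. x - y) ` N)"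
      using convex_translation[OF convex_negations[OF subspace_imp_convex[OF sub]], of x]
      by (simp add: image_image)
    moreover have "closed ((\<lambda>y. x - y) ` N)"
      using closed_translation[OF closed_negations[OF assms(1)], of x]
      by (simp add: image_image)
    ultimately obtain d where d: "d \<in> (\<lambda>y. x - y) ` N"
        "\<And>c. c \<in> (\<lambda>y. x - y) ` N \<Longrightarrow> 0 \<le> Re (cinner d (c - d))"
      by (metis closest_point_exists)
    then obtain y where y: "y \<in> N" "d = x - y"
      by blast
    have "cinner (x - y) z = 0" if "z \<in> N" for z
    proof (rule complex_eq_zero_by_rotation)
      fix c
      have "cnj c *\<^sub>C z \<in> N"
        using that assms(2) by (simp add: complex_subspace_def)
      then have "y - cnj c *\<^sub>C z \<in> N"
        using sub y(1) subspace_diff by blast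
      then have "0 \<le> Re (cinner d ((x - (y - cnj c *\<^sub>C z)) - d))"
        by (intro d(2)) blast
      then show "0 \<le> Re (c * cinner (x - y) z)"
        by (simp add: y(2) cinner_scaleC_right)
    qed
    with y(1) show ?thesis
      by blast
  qed
  have uniq: "y = y'" if "y \<in> N" "\<forall>z\<in>N. cinner (x - y) z = 0"
    "y' \<in> N" "\<forall>z\<in>N. cinner (x - y') z = 0" for y y'
  proof -
    have "y' - y \<in> N"
      using that sub subspace_diff by blast
    then have "cinner (x - y) (y' - y) - cinner (x - y') (y' - y) = 0"
      using that by simp
    then have "cinner (y' - y) (y' - y) = 0"
      by (simp add: cinner.diff_left[symmetric])
    then show ?thesis
      by (simp add: cinner_eq_zero_iff)
  qed
  have "ortho_proj N x \<in> N \<and> (\<forall>z\<in>N. cinner (x - ortho_proj N x) z = 0)"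
    unfolding ortho_proj_def by (rule theI') (use ex uniq in blast)
  then show "ortho_proj N x \<in> N" and "z \<in> N \<Longrightarrow> cinner (x - ortho_proj N x) z = 0"
    by auto
qed

lemma ortho_proj_eqI:
  fixes N :: "'h::complex_hilbert set"
  assumes "closed N" "complex_subspace N" "y \<in> N" "\<And>z. z \<in> N \<Longrightarrow> cinner (x - y) z = 0"
  shows "ortho_proj N x = y"
proof -
  let ?p = "ortho_proj N x"
  have "?p - y \<in> N"
    using ortho_proj(1)[OF assms(1,2)] assms(2,3) complex_subspace_imp_subspace subspace_diff
    by blast
  then have "cinner (x - y) (?p - y) - cinner (x - ?p) (?p - y) = 0"
    using ortho_proj(2)[OF assms(1,2)] assms(4) by simp
  then have "cinner (?p - y) (?p - y) = 0"
    by (simp add: cinner.diff_left[symmetric])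
  then show ?thesis
    by (simp add: cinner_eq_zero_iff)
qed

lemma norm_le_by_cinner:
  fixes p :: "'h::complex_hilbert"
  assumes "cmod (cinner p p) \<le> K * norm p" "0 \<le> K"
  shows "norm p \<le> K"
proof (cases "p = 0")
  case False
  have "norm p * norm p \<le> K * norm p"
    using assms(1) by (simp add: cinner_self power2_eq_square norm_mult)
  then show ?thesis
    using False by simp
qed (use assms in simp)

lemma norm_ortho_proj_le:
  fixes N :: "'h::complex_hilbert set"
  assumes "closed N" "complex_subspace N"
  shows "norm (ortho_proj N x) \<le> norm x"
proof (rule norm_le_by_cinner)
  let ?p = "ortho_proj N x"
  have "cinner ?p ?p = cinner x ?p"
    using ortho_proj(2)[OF assms, of ?p x] ortho_proj(1)[OF assms, of x]
    by (simp add: cinner.diff_left)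
  then show "cmod (cinner ?p ?p) \<le> norm x * norm ?p"
    using cauchy_schwarz[of x ?p] by simp
qed simp

text \<open>The representing vector is found on the level set \<open>f = 1\<close>: its element of least norm is
  orthogonal to the kernel of \<open>f\<close>.\<close>

lemma riesz_representation:
  fixes f :: "'h::complex_hilbert \<Rightarrow> complex"
  assumes add: "\<And>x y. f (x + y) = f x + f y"
    and scale: "\<And>c x. f (c *\<^sub>C x) = c * f x"
    and bound: "\<And>x. cmod (f x) \<le> K * norm x"
  obtains w where "\<And>x. f x = cinner x w"
proof (cases "\<forall>x. f x = 0")
  case True
  then show ?thesis
    by (intro that[of 0]) (simp add: cinner.zero_right)
next
  case False
  then obtain x0 where x0: "f x0 \<noteq> 0"
    by blast
  have bl: "bounded_linear f"
    by (rule bounded_linear_intro[where K = K])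
      (use bound in \<open>auto simp: add scaleR_scaleC scale scaleC_complex_def mult.commute\<close>)
  interpret f: bounded_linear f
    by (rule bl)
  define C where "C = {x. f x = 1}"
  have "closed C"
    unfolding C_def
    by (intro closed_Collect_eq continuous_on_const linear_continuous_on bl)
  moreover have "convex C"
    unfolding C_def convex_def
    by (auto simp: f.add f.scaleR simp flip: scaleR_add_left)
  moreover have "(1 / f x0) *\<^sub>C x0 \<in> C"
    using x0 by (simp add: C_def scale)
  ultimately obtain z where z: "z \<in> C" "\<And>c. c \<in> C \<Longrightarrow> 0 \<le> Re (cinner z (c - z))"
    using closest_point_exists by blast
  have fz: "f z = 1"
    using z(1) by (simp add: C_def)
  have ker: "cinner z k = 0" if "f k = 0" for k
  proof (rule complex_eq_zero_by_rotation)
    fix c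
    have "z + cnj c *\<^sub>C k \<in> C"
      using that by (simp add: C_def add scale fz)
    from z(2)[OF this] show "0 \<le> Re (c * cinner z k)"
      by (simp add: cinner_scaleC_right)
  qed
  have z0: "cinner z z \<noteq> 0"
    using fz by (auto simp: cinner_eq_zero_iff f.zero)
  show ?thesis
  proof (rule that[of "(1 / cinner z z) *\<^sub>C z"])
    fix x
    have "f (x - f x *\<^sub>C z) = 0"
      by (simp add: f.diff scale fz)
    then have "cinner (x - f x *\<^sub>C z) z = 0"
      using ker cinner_commute by (metis complex_cnj_zero)
    then have "cinner x z = f x * cinner z z"
      by (simp add: cinner.diff_left cinner_scaleC_left)
    then show "f x = cinner x ((1 / cinner z z) *\<^sub>C z)"
      using z0 cinner_commute[of z z] by (simp add: cinner_scaleC_right)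
  qed
qed

lemma bounded_form_represented:
  fixes f :: "'h::complex_hilbert \<Rightarrow> 'h \<Rightarrow> complex"
  assumes "\<And>x x' y. f (x + x') y = f x y + f x' y"
    and "\<And>x y y'. f x (y + y') = f x y + f x y'"
    and "\<And>c x y. f (c *\<^sub>C x) y = c * f x y"
    and "\<And>c x y. f x (c *\<^sub>C y) = cnj c * f x y"
    and bound: "\<And>x y. cmod (f x y) \<le> K * norm x * norm y" and "0 \<le> K"
  obtains S where "S \<in> bounded_ops" "norm S \<le> K" "\<And>x y. f x y = cinner (blinfun_apply S x) y"
proof -
  have "\<exists>w. \<forall>y. f x y = cinner w y" for x
  proof -
    obtain w where "\<And>y. cnj (f x y) = cinner y w"
      by (rule riesz_representation[of "\<lambda>y. cnj (f x y)" "K * norm x"])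
        (use assms in auto)
    then have "f x y = cinner w y" for y
      by (metis cinner_commute complex_cnj_cnj)
    then show ?thesis
      by blast
  qed
  then obtain s where s: "\<And>x y. f x y = cinner (s x) y"
    by metis
  have add: "s (x + x') = s x + s x'" for x x'
    by (rule cinner_eqI) (simp add: s[symmetric] assms cinner_add_left)
  have scale: "s (c *\<^sub>C x) = c *\<^sub>C s x" for c x
    by (rule cinner_eqI) (simp add: s[symmetric] assms cinner_scaleC_left)
  have nrm: "norm (s x) \<le> K * norm x" for x
    by (rule norm_le_by_cinner) (use bound[of x "s x"] \<open>0 \<le> K\<close> s in simp_all)
  have "bounded_linear s"
    by (rule bounded_linear_intro[where K = K])
      (use nrm in \<open>auto simp: add scaleR_scaleC scale mult.commute\<close>)
  then have app: "blinfun_apply (Blinfun s) = s"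
    by (rule bounded_linear_Blinfun_apply)
  show ?thesis
  proof (rule that[of "Blinfun s"])
    show "Blinfun s \<in> bounded_ops"
      by (simp add: bounded_ops_def app scale)
    show "norm (Blinfun s) \<le> K"
      by (rule norm_blinfun_bound) (use nrm \<open>0 \<le> K\<close> app in auto)
  qed (simp add: app s)
qed

lemma cmod_cinner_apply_le:
  "cmod (cinner (blinfun_apply S x) y) \<le> norm S * norm x * norm (y::'h::complex_hilbert)"
proof -
  have "cmod (cinner (blinfun_apply S x) y) \<le> norm (blinfun_apply S x) * norm y"
    by (rule cauchy_schwarz)
  also have "\<dots> \<le> norm S * norm x * norm y"
    by (intro mult_right_mono norm_blinfun norm_ge_zero)
  finally show ?thesis .
qed

lemma cinner_adj_op:
  fixes A :: "'h::complex_hilbert \<Rightarrow>\<^sub>L 'h"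
  assumes "A \<in> bounded_ops"
  shows "cinner (blinfun_apply A x) y = cinner x (blinfun_apply (adj_op A) y)"
proof -
  let ?P = "\<lambda>B. \<forall>x y. cinner (blinfun_apply A x) y = cinner x (blinfun_apply B y)"
  have sc: "blinfun_apply A (c *\<^sub>C x) = c *\<^sub>C blinfun_apply A x" for c x
    using assms by (simp add: bounded_ops_def)
  obtain B where B: "\<And>x y. cinner x (blinfun_apply A y) = cinner (blinfun_apply B x) y"
    by (rule bounded_form_represented[of "\<lambda>x y. cinner x (blinfun_apply A y)" "norm A"])
      (auto simp: cinner_add_left cinner_add_right cinner_scaleC_left cinner_scaleC_right
        blinfun.add_right sc cinner_commute[of _ "blinfun_apply A _"] mult_ac
        intro: order_trans[OF cmod_cinner_apply_le])
  have PB: "?P B"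
    using B by (metis cinner_commute)
  have "?P (adj_op A)"
    unfolding adj_op_def
  proof (rule theI)
    show "?P B"
      by (rule PB)
    fix B'
    assume "?P B'"
    then have "cinner (blinfun_apply B' y) x = cinner (blinfun_apply B y) x" for x y
      using PB by (metis cinner_commute)
    then show "B' = B"
      by (meson blinfun_eqI cinner_eqI)
  qed
  then show ?thesis
    by blast
qed


section \<open>Orthonormal bases and vector functionals\<close>

lemma finite_fourier:
  fixes E F :: "'h::complex_hilbert set"
  assumes orthonormal: "\<And>e f. e \<in> E \<Longrightarrow> f \<in> E \<Longrightarrow> cinner e f = (if e = f then 1 else 0)"
    and F: "finite F" "F \<subseteq> E" and "e \<in> E"
  shows "cinner (\<Sum>f\<in>F. c f *\<^sub>C f) e = (if e \<in> F then c e else 0)"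
proof -
  have "cinner (\<Sum>f\<in>F. c f *\<^sub>C f) e = (\<Sum>f\<in>F. if f = e then c f else 0)"
    unfolding cinner.sum_left
    using F(2) \<open>e \<in> E\<close> by (intro sum.cong) (auto simp: cinner_scaleC_left orthonormal subset_iff)
  then show ?thesis
    using F(1) by (simp add: if_distrib)
qed

lemma norm_fourier_remainder_le:
  fixes E F :: "'h::complex_hilbert set"
  assumes orthonormal: "\<And>e f. e \<in> E \<Longrightarrow> f \<in> E \<Longrightarrow> cinner e f = (if e = f then 1 else 0)"
    and F: "finite F" "F \<subseteq> E"
  shows "norm (u - (\<Sum>e\<in>F. cinner u e *\<^sub>C e)) \<le> norm u"
proof -
  define p where "p = (\<Sum>e\<in>F. cinner u e *\<^sub>C e)"
  have "cinner (u - p) e = 0" if "e \<in> F" for e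
    using that finite_fourier[OF orthonormal F, of e "cinner u"] F(2)
    by (auto simp: p_def cinner.diff_left)
  then have "cinner (u - p) p = 0"
    by (simp add: p_def cinner.sum_right cinner_scaleC_right)
  then have "(norm ((u - p) + p))\<^sup>2 = (norm (u - p))\<^sup>2 + (norm p)\<^sup>2"
    by (simp only: norm_add_sq) simp
  then have "(norm (u - p))\<^sup>2 \<le> (norm u)\<^sup>2"
    by simp
  then show ?thesis
    unfolding p_def by (rule power2_le_imp_le) simp
qed

text \<open>The vectors whose Fourier expansion eventually reproduces them exactly form a dense subspace,
  since maximality of \<open>E\<close> leaves nothing orthogonal to its closure; the remainder estimate
  carries the expansion over to the closure.\<close>

lemma fourier_expansion:
  fixes E :: "'h::complex_hilbert set"
  assumes "orthonormal_basis E"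
  shows "((\<lambda>e. cinner u e *\<^sub>C e) has_sum u) E"
proof -
  have on: "\<And>e f. e \<in> E \<Longrightarrow> f \<in> E \<Longrightarrow> cinner e f = (if e = f then 1 else 0)"
    and maximal: "\<And>x. (\<And>e. e \<in> E \<Longrightarrow> cinner x e = 0) \<Longrightarrow> x = 0"
    using assms by (auto simp: orthonormal_basis_def)
  define r where "r F v = v - (\<Sum>e\<in>F. cinner v e *\<^sub>C e)" for F and v :: 'h
  have r_add: "r F (v + w) = r F v + r F w" for F v w
    by (simp add: r_def cinner_add_left scaleC_add_left sum.distrib algebra_simps)
  have r_scale: "r F (c *\<^sub>C v) = c *\<^sub>C r F v" for F c v
  proof -
    interpret s: bounded_linear "\<lambda>x::'h. c *\<^sub>C x"
      by (rule bounded_linear_scaleC)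
    show ?thesis
      by (simp add: r_def s.diff s.sum cinner_scaleC_left scaleC_scaleC)
  qed
  define D where "D = {v. \<exists>F. finite F \<and> F \<subseteq> E \<and> (\<forall>G. finite G \<and> F \<subseteq> G \<and> G \<subseteq> E \<longrightarrow> r G v = 0)}"
  have "complex_subspace D"
    unfolding complex_subspace_def
  proof (intro conjI ballI allI)
    have "r G 0 = 0" for G
      using r_scale[of G 0 0] by (simp add: scaleC_zero_left)
    then show "0 \<in> D"
      by (auto simp: D_def)
  next
    fix v w
    assume "v \<in> D" "w \<in> D"
    then obtain F F' where "finite F" "F \<subseteq> E" "\<forall>G. finite G \<and> F \<subseteq> G \<and> G \<subseteq> E \<longrightarrow> r G v = 0"
      and "finite F'" "F' \<subseteq> E" "\<forall>G. finite G \<and> F' \<subseteq> G \<and> G \<subseteq> E \<longrightarrow> r G w = 0"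
      unfolding D_def by blast
    then show "v + w \<in> D"
      unfolding D_def by (intro CollectI exI[of _ "F \<union> F'"]) (simp add: r_add)
  next
    fix c v
    assume "v \<in> D"
    then obtain F where "finite F" "F \<subseteq> E" "\<forall>G. finite G \<and> F \<subseteq> G \<and> G \<subseteq> E \<longrightarrow> r G v = 0"
      unfolding D_def by blast
    moreover have "c *\<^sub>C (0::'h) = 0"
      using norm_scaleC[of c "0::'h"] by simp
    ultimately show "c *\<^sub>C v \<in> D"
      unfolding D_def by (intro CollectI exI[of _ F]) (simp add: r_scale)
  qed
  then have D: "closed (closure D)" "complex_subspace (closure D)"
    by (simp_all add: complex_subspace_closure)
  have "e \<in> D" if "e \<in> E" for e
  proof -
    have "r G e = 0" if "finite G" "{e} \<subseteq> G" "G \<subseteq> E" for G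
    proof -
      have "(\<Sum>f\<in>G. cinner e f *\<^sub>C f) = (\<Sum>f\<in>G. if f = e then e else 0)"
        using that \<open>e \<in> E\<close>
        by (intro sum.cong) (auto simp: on subset_iff scaleC_one scaleC_zero_left)
      then show ?thesis
        using that by (simp add: r_def)
    qed
    then show ?thesis
      using that unfolding D_def by (intro CollectI exI[of _ "{e}"]) simp
  qed
  then have "u - ortho_proj (closure D) u = 0"
    using ortho_proj(2)[OF D] closure_subset by (intro maximal) blast
  then have u: "u \<in> closure D"
    using ortho_proj(1)[OF D, of u] by simp
  show ?thesis
    unfolding has_sum_def tendsto_iff eventually_finite_subsets_at_top
  proof (intro allI impI)
    fix \<epsilon> :: real
    assume "\<epsilon> > 0"
    then obtain v where v: "v \<in> D" "dist v u < \<epsilon>"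
      using u closure_approachable by blast
    then obtain F where F: "finite F" "F \<subseteq> E" "\<forall>G. finite G \<and> F \<subseteq> G \<and> G \<subseteq> E \<longrightarrow> r G v = 0"
      unfolding D_def by blast
    have "dist (\<Sum>e\<in>G. cinner u e *\<^sub>C e) u < \<epsilon>" if G: "finite G" "F \<subseteq> G" "G \<subseteq> E" for G
    proof -
      have "r G (u - v) = r G u"
        using r_add[of G "u - v" v] F(3) G by simp
      moreover have "norm (r G (u - v)) \<le> norm (u - v)"
        unfolding r_def by (rule norm_fourier_remainder_le[OF on G(1,3)])
      ultimately have "norm (r G u) < \<epsilon>"
        using v(2) by (simp add: dist_norm norm_minus_commute)
      then show ?thesis
        by (simp add: r_def dist_norm norm_minus_commute)
    qed
    then show "\<exists>X. finite X \<and> X \<subseteq> E \<and>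
        (\<forall>Y. finite Y \<and> X \<subseteq> Y \<and> Y \<subseteq> E \<longrightarrow> dist (\<Sum>e\<in>Y. cinner u e *\<^sub>C e) u < \<epsilon>)"
      using F by blast
  qed
qed

lemma orthonormal_basis_some_onb: "orthonormal_basis (some_onb :: 'h::complex_hilbert set)"
proof -
  define \<O> where "\<O> = {E :: 'h set. \<forall>e\<in>E. \<forall>f\<in>E. cinner e f = (if e = f then 1 else 0)}"
  have "\<exists>M\<in>\<O>. \<forall>X\<in>\<O>. M \<subseteq> X \<longrightarrow> X = M"
  proof (rule subset_Zorn')
    fix \<C>
    assume chain: "subset.chain \<O> \<C>"
    have "cinner e f = (if e = f then 1 else 0)" if ef: "e \<in> \<Union>\<C>" "f \<in> \<Union>\<C>" for e f
    proof -
      obtain X where "X \<in> \<C>" "e \<in> X" "f \<in> X"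
        using ef chain unfolding subset.chain_def by blast
      then show ?thesis
        using chain unfolding subset.chain_def \<O>_def by blast
    qed
    then show "\<Union>\<C> \<in> \<O>"
      by (simp add: \<O>_def)
  qed
  then obtain M where M: "M \<in> \<O>" "\<And>X. X \<in> \<O> \<Longrightarrow> M \<subseteq> X \<Longrightarrow> X = M"
    by blast
  have "x = 0" if orth: "\<And>e. e \<in> M \<Longrightarrow> cinner x e = 0" for x
  proof (rule ccontr)
    assume "x \<noteq> 0"
    define y where "y = (1 / norm x) *\<^sub>R x"
    have "norm y = 1"
      using \<open>x \<noteq> 0\<close> by (simp add: y_def)
    then have yy: "cinner y y = 1"
      by (simp add: cinner_self)
    have ye: "cinner y e = 0" "cinner e y = 0" if "e \<in> M" for e
      using orth[OF that] cinner_commute[of e x]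
      by (simp_all add: y_def cinner.scaleR_left cinner.scaleR_right)
    then have "y \<notin> M"
      using yy by auto
    have "insert y M \<in> \<O>"
      using M(1) ye yy unfolding \<O>_def by (auto split: if_splits)
    then have "insert y M = M"
      using M(2) by blast
    then show False
      using \<open>y \<notin> M\<close> by blast
  qed
  then have "orthonormal_basis M"
    using M(1) unfolding orthonormal_basis_def \<O>_def by blast
  then show ?thesis
    unfolding some_onb_def by (rule someI)
qed

lemma parseval:
  fixes u v :: "'h::complex_hilbert"
  shows "((\<lambda>e. cinner u e * cinner e v) has_sum cinner u v) some_onb"
  using has_sum_bounded_linear[OF cinner.bounded_linear_left[of v]
      fourier_expansion[OF orthonormal_basis_some_onb, of u]]
  by (simp add: cinner_scaleC_left)

definition rank_one :: "'h::complex_hilbert \<Rightarrow> 'h \<Rightarrow> 'h \<Rightarrow>\<^sub>L 'h" where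
  "rank_one x y = Blinfun (\<lambda>z. cinner z y *\<^sub>C x)"

lemma rank_one_apply: "blinfun_apply (rank_one x y) z = cinner z y *\<^sub>C (x::'h::complex_hilbert)"
proof -
  have "bounded_linear (\<lambda>z. cinner z y *\<^sub>C x)"
  proof (rule bounded_linear_intro[where K = "norm y * norm x"])
    show "norm (cinner z y *\<^sub>C x) \<le> norm z * (norm y * norm x)" for z
      using mult_right_mono[OF cauchy_schwarz[of z y], of "norm x"] by (simp add: norm_scaleC)
  qed (simp_all add: cinner_add_left scaleC_add_left scaleR_scaleC cinner_scaleC_left
      scaleC_scaleC)
  then show ?thesis
    by (simp add: rank_one_def bounded_linear_Blinfun_apply)
qed

lemma rank_one_in_bounded_ops: "rank_one x y \<in> bounded_ops"
  by (simp add: bounded_ops_def rank_one_apply cinner_scaleC_left scaleC_scaleC)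

lemma op_trace_comp_rank_one:
  assumes "A \<in> bounded_ops"
  shows "op_trace (A o\<^sub>L rank_one x y) = cinner (blinfun_apply A x) y"
proof -
  have "((\<lambda>e. cinner (blinfun_apply A x) e * cinner e y) has_sum cinner (blinfun_apply A x) y)
      some_onb"
    by (rule parseval)
  then show ?thesis
    using assms unfolding op_trace_def
    by (intro infsumI)
      (simp add: rank_one_apply bounded_ops_def cinner_scaleC_left mult.commute)
qed

text \<open>For \<open>T z = \<langle>z, y\<rangle> x\<close> the modulus is the multiple \<open>\<parallel>x\<parallel> / \<parallel>y\<parallel>\<close> of
  \<open>z \<mapsto> \<langle>z, y\<rangle> y\<close>; for \<open>y = 0\<close> both vanish.\<close>

lemma rank_one_trace_class: "rank_one x y \<in> trace_class"
proof -
  define k where "k = norm x / norm y"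
  define S where "S = rank_one (k *\<^sub>R y) y"
  have S: "blinfun_apply S z = (complex_of_real k * cinner z y) *\<^sub>C y" for z
    by (simp add: S_def rank_one_apply scaleR_scaleC scaleC_scaleC mult.commute)
  have quad: "cinner (blinfun_apply S z) z = complex_of_real (k * (cmod (cinner z y))\<^sup>2)" for z
    using cinner_commute[of y z] complex_norm_square[of "cinner z y"]
    by (simp add: S cinner_scaleC_left)
  have "positive_op S"
    using rank_one_in_bounded_ops[of "k *\<^sub>R y" y]
    unfolding positive_op_def quad by (simp add: S_def k_def)
  moreover have "S o\<^sub>L S = adj_op (rank_one x y) o\<^sub>L rank_one x y"
  proof (rule blinfun_eqI, rule cinner_eqI)
    fix z w
    have sq: "complex_of_real k * complex_of_real k * cinner y y * c = cinner x x * c"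
      if "y = 0 \<Longrightarrow> c = 0" for c
      using that by (cases "y = 0") (simp_all add: k_def cinner_self power2_eq_square)
    have "cinner (blinfun_apply (adj_op (rank_one x y) o\<^sub>L rank_one x y) z) w
        = cinner (blinfun_apply (rank_one x y) z) (blinfun_apply (rank_one x y) w)"
      using cinner_adj_op[OF rank_one_in_bounded_ops, of x y w "blinfun_apply (rank_one x y) z"]
      by (metis blinfun_apply_blinfun_compose cinner_commute)
    also have "\<dots> = cinner x x * (cinner z y * cinner y w)"
      using cinner_commute[of w y]
      by (simp add: rank_one_apply cinner_scaleC_left cinner_scaleC_right)
    also have "\<dots> = complex_of_real k * complex_of_real k * cinner y y * (cinner z y * cinner y w)"
      by (rule sq[symmetric]) (simp add: cinner.zero_right)
    also have "\<dots> = cinner (blinfun_apply (S o\<^sub>L S) z) w"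
      by (simp add: S cinner_scaleC_left)
    finally show "cinner (blinfun_apply (S o\<^sub>L S) z) w
        = cinner (blinfun_apply (adj_op (rank_one x y) o\<^sub>L rank_one x y) z) w"
      by (rule sym)
  qed
  moreover have "(\<lambda>e. cinner (blinfun_apply S e) e) summable_on some_onb"
  proof -
    have "((\<lambda>e. complex_of_real k * (cinner y e * cinner e y))
        has_sum (complex_of_real k * cinner y y)) some_onb"
      by (intro has_sum_cmult_right parseval)
    then show ?thesis
      by (auto simp: S cinner_scaleC_left mult_ac intro: has_sum_imp_summable)
  qed
  ultimately show ?thesis
    using rank_one_in_bounded_ops unfolding trace_class_def by blast
qed

lemma topspace_weak_star_topology: "topspace weak_star_topology = bounded_ops"
proof -
  have "bounded_ops \<subseteq> \<Union> {{A \<in> bounded_ops. op_trace (A o\<^sub>L T) \<in> U} | T U. T \<in> trace_class \<and> open U}"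
    using rank_one_trace_class by (auto intro!: exI[of _ UNIV])
  then show ?thesis
    unfolding weak_star_topology_def topology_generated_by_topspace by blast
qed

lemma continuous_map_vector_functional:
  "continuous_map weak_star_topology euclidean (\<lambda>A. cinner (blinfun_apply A x) y)"
  unfolding continuous_map topspace_weak_star_topology
proof (intro conjI allI impI)
  fix U :: "complex set"
  assume "openin euclidean U"
  then have "openin weak_star_topology {A \<in> bounded_ops. op_trace (A o\<^sub>L rank_one x y) \<in> U}"
    unfolding weak_star_topology_def using rank_one_trace_class
    by (intro topology_generated_by_Basis) auto
  moreover have "{A \<in> bounded_ops. op_trace (A o\<^sub>L rank_one x y) \<in> U}
      = {A \<in> bounded_ops. cinner (blinfun_apply A x) y \<in> U}"
    by (auto simp: op_trace_comp_rank_one)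
  ultimately show "openin weak_star_topology {A \<in> bounded_ops. cinner (blinfun_apply A x) y \<in> U}"
    by simp
qed auto


section \<open>Distance to a weak-operator closed subspace\<close>

definition matrix_entry :: "('h::complex_hilbert \<Rightarrow>\<^sub>L 'h) \<Rightarrow> 'h \<times> 'h \<Rightarrow> complex" where
  "matrix_entry S p = cinner (blinfun_apply S (fst p)) (snd p)"

lemma matrix_entry_add: "matrix_entry (S + T) p = matrix_entry S p + matrix_entry T p"
  by (simp add: matrix_entry_def blinfun.add_left cinner_add_left)

lemma matrix_entry_diff: "matrix_entry (S - T) p = matrix_entry S p - matrix_entry T p"
  by (simp add: matrix_entry_def blinfun.diff_left cinner.diff_left)

lemma matrix_entry_scaleR: "matrix_entry (a *\<^sub>R S) p = a *\<^sub>R matrix_entry S p"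
  by (simp add: matrix_entry_def blinfun.scaleR_left cinner.scaleR_left)

lemma scale_op_apply: "blinfun_apply (scale_op c S) x = c *\<^sub>C blinfun_apply S x"
  by (simp add: scale_op.rep_eq)

lemma matrix_entry_scale_op: "matrix_entry (scale_op c S) p = c * matrix_entry S p"
  by (simp add: matrix_entry_def scale_op_apply cinner_scaleC_left)

lemma norm_scale_op_le: "norm (scale_op c S) \<le> cmod c * norm S"
proof (rule norm_blinfun_bound)
  show "norm (blinfun_apply (scale_op c S) x) \<le> cmod c * norm S * norm x" for x
    using mult_left_mono[OF norm_blinfun[of S x], of "cmod c"]
    by (simp add: scale_op_apply norm_scaleC mult.assoc)
qed simp

lemma op_subspace_bounded_ops: "op_subspace (bounded_ops :: ('h::complex_hilbert \<Rightarrow>\<^sub>L 'h) set)"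
proof -
  have "c *\<^sub>C (0::'h) = 0" for c
    using norm_scaleC[of c "0::'h"] by simp
  then show ?thesis
    by (auto simp: op_subspace_def bounded_ops_def blinfun.add_left scaleC_add_right scale_op_apply
        scaleC_scaleC mult.commute)
qed

lemma op_subspace_imp_subspace:
  fixes M :: "('h::complex_hilbert \<Rightarrow>\<^sub>L 'h) set"
  assumes "op_subspace M"
  shows "subspace M"
proof -
  have "a *\<^sub>R S = scale_op (complex_of_real a) S" for a and S :: "'h \<Rightarrow>\<^sub>L 'h"
    by (rule blinfun_eqI) (simp add: scale_op_apply scaleR_scaleC blinfun.scaleR_left)
  then show ?thesis
    using assms by (simp add: op_subspace_def subspace_def)
qed

lemma weak_operator_neighbourhood:
  fixes T :: "'h::complex_hilbert \<Rightarrow>\<^sub>L 'h"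
  assumes "openin weak_operator_topology U" and "T \<in> U"
  shows "\<exists>P \<epsilon>. finite P \<and> \<epsilon> > 0 \<and>
    (\<forall>S\<in>bounded_ops. (\<forall>p\<in>P. cmod (matrix_entry S p - matrix_entry T p) < \<epsilon>) \<longrightarrow> S \<in> U)"
proof -
  have "generate_topology_on {{A \<in> bounded_ops. cinner (blinfun_apply A x) y \<in> V} | x y V. open V} U"
    using assms(1) by (simp add: weak_operator_topology_def openin_topology_generated_by_iff)
  then show ?thesis
    using \<open>T \<in> U\<close>
  proof induction
    case Empty
    then show ?case
      by simp
  next
    case (Int a b)
    from Int obtain P \<epsilon> where P: "finite P" "\<epsilon> > 0"
      "\<And>S. S \<in> bounded_ops \<Longrightarrow> \<forall>p\<in>P. cmod (matrix_entry S p - matrix_entry T p) < \<epsilon> \<Longrightarrow> S \<in> a"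
      by blast
    from Int obtain P' \<epsilon>' where P': "finite P'" "\<epsilon>' > 0"
      "\<And>S. S \<in> bounded_ops \<Longrightarrow> \<forall>p\<in>P'. cmod (matrix_entry S p - matrix_entry T p) < \<epsilon>' \<Longrightarrow> S \<in> b"
      by blast
    show ?case
      using P P' by (intro exI[of _ "P \<union> P'"] exI[of _ "min \<epsilon> \<epsilon>'"]) simp
  next
    case (UN K)
    then obtain W where W: "W \<in> K" "T \<in> W"
      by blast
    with UN.IH[OF W] show ?case
      by (meson UnionI)
  next
    case (Basis s)
    then obtain x y V where s: "s = {A \<in> bounded_ops. cinner (blinfun_apply A x) y \<in> V}" "open V"
      by blast
    with Basis obtain \<epsilon> where "\<epsilon> > 0" "\<And>w. dist w (matrix_entry T (x, y)) < \<epsilon> \<Longrightarrow> w \<in> V"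
      unfolding open_dist matrix_entry_def by auto
    then show ?case
      by (intro exI[of _ "{(x, y)}"] exI[of _ \<epsilon>]) (auto simp: s matrix_entry_def dist_norm)
  qed
qed

lemma topspace_weak_operator_topology: "topspace weak_operator_topology = bounded_ops"
proof -
  have "bounded_ops \<subseteq> \<Union> {{A \<in> bounded_ops. cinner (blinfun_apply A x) y \<in> U} | x y U. open U}"
    by (auto intro!: exI[of _ UNIV])
  then show ?thesis
    unfolding weak_operator_topology_def topology_generated_by_topspace by blast
qed

text \<open>Weak operator compactness of balls: matrix entries identify the ball with the sesquilinear
  forms in a product of discs, which is compact by Tychonoff's theorem.\<close>

lemma compact_matrix_entries_ball:
  fixes r :: real
  assumes "0 \<le> r"
  shows "compact (matrix_entry ` {S \<in> bounded_ops. norm (S :: 'h::complex_hilbert \<Rightarrow>\<^sub>L 'h) \<le> r})"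
proof -
  define D where "D = (PiE UNIV (\<lambda>p :: 'h \<times> 'h. cball (0::complex) (r * norm (fst p) * norm (snd p))))"
  define F where "F = {f :: 'h \<times> 'h \<Rightarrow> complex.
    (\<forall>x x' y. f (x + x', y) = f (x, y) + f (x', y)) \<and>
    (\<forall>x y y'. f (x, y + y') = f (x, y) + f (x, y')) \<and>
    (\<forall>c x y. f (c *\<^sub>C x, y) = c * f (x, y)) \<and>
    (\<forall>c x y. f (x, c *\<^sub>C y) = cnj c * f (x, y))}"
  have "compactin (product_topology (\<lambda>_. euclidean) UNIV) D"
    unfolding D_def by (simp add: compactin_PiE)
  then have "compact D"
    by (simp add: euclidean_product_topology)
  moreover have "closed F"
    unfolding F_def
    by (intro closed_Collect_conj closed_Collect_all closed_Collect_eq continuous_intros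
        continuous_on_product_coordinates)
  moreover have "matrix_entry ` {S \<in> bounded_ops. norm S \<le> r} = D \<inter> F"
  proof (intro equalityI subsetI)
    fix f :: "'h \<times> 'h \<Rightarrow> complex"
    assume "f \<in> matrix_entry ` {S \<in> bounded_ops. norm S \<le> r}"
    then obtain S where S: "S \<in> bounded_ops" "norm S \<le> r" "f = matrix_entry S"
      by blast
    have "cmod (f p) \<le> r * norm (fst p) * norm (snd p)" for p
    proof -
      have "cmod (f p) \<le> norm S * norm (fst p) * norm (snd p)"
        unfolding S(3) matrix_entry_def by (rule cmod_cinner_apply_le)
      also have "\<dots> \<le> r * norm (fst p) * norm (snd p)"
        using S(2) by (intro mult_right_mono) auto
      finally show ?thesis .
    qed
    then have "f \<in> D"
      by (auto simp: D_def)
    moreover have "f \<in> F"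
      using S(1)
      by (simp add: F_def S(3) matrix_entry_def bounded_ops_def blinfun.add_right cinner_add_left
          cinner_add_right cinner_scaleC_left cinner_scaleC_right)
    ultimately show "f \<in> D \<inter> F"
      by blast
  next
    fix f :: "'h \<times> 'h \<Rightarrow> complex"
    assume f: "f \<in> D \<inter> F"
    then have "cmod (f (x, y)) \<le> r * norm x * norm y" for x y
      by (auto simp: D_def PiE_iff)
    with f assms obtain S where "S \<in> bounded_ops" "norm S \<le> r"
      "\<And>x y. f (x, y) = cinner (blinfun_apply S x) y"
      by (auto simp: F_def intro: bounded_form_represented[of "\<lambda>x y. f (x, y)" r])
    moreover from this have "f = matrix_entry S"
      by (auto simp: matrix_entry_def)
    ultimately show "f \<in> matrix_entry ` {S \<in> bounded_ops. norm S \<le> r}"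
      by blast
  qed
  ultimately show ?thesis
    by (simp add: compact_Int_closed)
qed

text \<open>By compactness, finitely many matrix entries already see that a ball around \<open>A\<close> misses a
  weak-operator closed set. This reduces the separation of the two to finite dimensions.\<close>

lemma finitely_many_entries_separate:
  fixes A :: "'h::complex_hilbert \<Rightarrow>\<^sub>L 'h"
  assumes closed: "closedin weak_operator_topology J" and "A \<in> bounded_ops" and "0 \<le> r"
    and disjoint: "\<And>S. S \<in> bounded_ops \<Longrightarrow> norm S \<le> r \<Longrightarrow> A - S \<notin> J"
  obtains P \<delta> where "finite P" and "\<delta> > 0"
    and "\<And>S B. S \<in> bounded_ops \<Longrightarrow> norm S \<le> r \<Longrightarrow> B \<in> J \<Longrightarrow>
      \<exists>p\<in>P. \<delta> \<le> cmod (matrix_entry (A - S - B) p)"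
proof -
  let ?K = "{S \<in> bounded_ops. norm (S :: 'h \<Rightarrow>\<^sub>L 'h) \<le> r}"
  define separates where "separates S P \<epsilon> \<longleftrightarrow> finite P \<and> \<epsilon> > 0 \<and>
    (\<forall>B\<in>J. \<exists>p\<in>P. \<epsilon> \<le> cmod (matrix_entry B p - matrix_entry (A - S) p))" for S P and \<epsilon> :: real
  have "\<exists>P \<epsilon>. separates S P \<epsilon>" if S: "S \<in> ?K" for S
  proof -
    have "openin weak_operator_topology (bounded_ops - J)"
      using closed openin_diff[OF openin_topspace closed]
      by (simp add: topspace_weak_operator_topology)
    moreover have "A - S \<in> bounded_ops - J"
      using S disjoint \<open>A \<in> bounded_ops\<close>
        subspace_diff[OF op_subspace_imp_subspace[OF op_subspace_bounded_ops]]
      by blast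
    ultimately have "\<exists>P \<epsilon>. finite P \<and> \<epsilon> > 0 \<and> (\<forall>B\<in>bounded_ops.
        (\<forall>p\<in>P. cmod (matrix_entry B p - matrix_entry (A - S) p) < \<epsilon>) \<longrightarrow> B \<in> bounded_ops - J)"
      by (rule weak_operator_neighbourhood)
    then obtain P \<epsilon> where P: "finite P" "\<epsilon> > 0" "\<forall>B\<in>bounded_ops.
        (\<forall>p\<in>P. cmod (matrix_entry B p - matrix_entry (A - S) p) < \<epsilon>) \<longrightarrow> B \<in> bounded_ops - J"
      by blast
    have J: "J \<subseteq> bounded_ops"
      using closed closedin_subset topspace_weak_operator_topology by blast
    have "\<exists>p\<in>P. \<epsilon> \<le> cmod (matrix_entry B p - matrix_entry (A - S) p)" if "B \<in> J" for B
    proof (rule ccontr)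
      assume "\<not> ?thesis"
      then have "\<forall>p\<in>P. cmod (matrix_entry B p - matrix_entry (A - S) p) < \<epsilon>"
        by (simp add: not_le)
      then have "B \<in> bounded_ops - J"
        using P(3) J that by blast
      then show False
        using that by simp
    qed
    with P(1,2) show ?thesis
      unfolding separates_def by blast
  qed
  then obtain P \<epsilon> where "\<And>S. S \<in> ?K \<Longrightarrow> separates S (P S) (\<epsilon> S)"
    by metis
  then have P: "\<And>S. S \<in> ?K \<Longrightarrow> finite (P S)" "\<And>S. S \<in> ?K \<Longrightarrow> \<epsilon> S > 0"
    "\<And>S B. S \<in> ?K \<Longrightarrow> B \<in> J \<Longrightarrow> \<exists>p\<in>P S. \<epsilon> S \<le> cmod (matrix_entry B p - matrix_entry (A - S) p)"
    unfolding separates_def by blast+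
  define V where "V S = (\<Inter>p\<in>P S. {f. cmod (f p - matrix_entry S p) < \<epsilon> S / 2})" for S
  have V_open: "open (V S)" if "S \<in> ?K" for S
    unfolding V_def using P(1)[OF that]
    by (intro open_INT ballI open_Collect_less continuous_intros
        continuous_on_product_coordinates)
  have cover: "matrix_entry ` ?K \<subseteq> (\<Union>S\<in>?K. V S)"
    using P(2) by (force simp: V_def)
  obtain D where D: "D \<subseteq> ?K" "finite D" "matrix_entry ` ?K \<subseteq> (\<Union>S\<in>D. V S)"
    by (rule compactE_image[OF compact_matrix_entries_ball[OF \<open>0 \<le> r\<close>] V_open cover])
  have "0 \<in> ?K"
    using \<open>0 \<le> r\<close> op_subspace_bounded_ops by (auto simp: op_subspace_def)
  then have "D \<noteq> {}"
    using D(3) by blast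
  \<comment> \<open>Half of each tolerance pays for moving from \<open>S\<close> to the centre of the cover element that
    contains it, and \<open>\<delta>\<close> has to fit into the other half.\<close>
  define \<delta> where "\<delta> = Min ((\<lambda>S. \<epsilon> S / 2) ` D)"
  show ?thesis
  proof (rule that[of "\<Union>S\<in>D. P S" \<delta>])
    show "finite (\<Union>S\<in>D. P S)"
      using D P(1) by blast
    show "\<delta> > 0"
      unfolding \<delta>_def using D P(2) \<open>D \<noteq> {}\<close> by (subst Min_gr_iff) (auto simp: subset_iff)
    fix S B :: "'h \<Rightarrow>\<^sub>L 'h"
    assume S: "S \<in> bounded_ops" "norm S \<le> r" and "B \<in> J"
    then have "matrix_entry S \<in> (\<Union>S\<in>D. V S)"
      using D(3) by blast
    then obtain T where T: "T \<in> D" "matrix_entry S \<in> V T"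
      by blast
    then have "T \<in> ?K"
      using D(1) by blast
    then obtain p where p: "p \<in> P T" "\<epsilon> T \<le> cmod (matrix_entry B p - matrix_entry (A - T) p)"
      using P(3) \<open>B \<in> J\<close> by blast
    have "cmod (matrix_entry S p - matrix_entry T p) < \<epsilon> T / 2"
      using T(2) p(1) by (auto simp: V_def)
    moreover have "matrix_entry B p - matrix_entry (A - T) p
        = - (matrix_entry (A - S - B) p) - (matrix_entry S p - matrix_entry T p)"
      by (simp add: matrix_entry_diff)
    then have "cmod (matrix_entry B p - matrix_entry (A - T) p)
        \<le> cmod (matrix_entry (A - S - B) p) + cmod (matrix_entry S p - matrix_entry T p)"
      using norm_triangle_ineq4[of "- (matrix_entry (A - S - B) p)"] by (metis norm_minus_cancel)
    moreover have "\<delta> \<le> \<epsilon> T / 2"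
      unfolding \<delta>_def using D(2) T(1) by (intro Min_le) auto
    ultimately have "\<delta> \<le> cmod (matrix_entry (A - S - B) p)"
      using p(2) by linarith
    then show "\<exists>p\<in>(\<Union>S\<in>D. P S). \<delta> \<le> cmod (matrix_entry (A - S - B) p)"
      using T(1) p(1) by blast
  qed
qed

text \<open>Separation in \<open>\<complex>\<^sup>n\<close>: the functional is the inner product with the point of least norm in the
  closure of the image of \<open>C\<close>, obtained as the limit of a minimising sequence.\<close>

lemma finite_dimensional_separation:
  fixes s :: "'i \<Rightarrow> 'v::real_vector \<Rightarrow> complex"
  assumes "finite I"
    and add: "\<And>i u v. s i (u + v) = s i u + s i v"
    and scale: "\<And>i a v. s i (a *\<^sub>R v) = a *\<^sub>R s i v"
    and C: "convex C" "C \<noteq> {}"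
    and m: "\<And>c. c \<in> C \<Longrightarrow> m \<le> (\<Sum>i\<in>I. (cmod (s i c))\<^sup>2)"
  obtains l where "\<And>c. c \<in> C \<Longrightarrow> m \<le> Re (\<Sum>i\<in>I. l i * s i c)"
proof -
  let ?q = "\<lambda>v. \<Sum>i\<in>I. (cmod (s i v))\<^sup>2"
  have diff: "s i (u - v) = s i u - s i v" for i u v
    using add[of i u "(- 1) *\<^sub>R v"] scale[of i "- 1" v] by simp
  have par: "(cmod (a + b))\<^sup>2 + (cmod (a - b))\<^sup>2 = 2 * (cmod a)\<^sup>2 + 2 * (cmod b)\<^sup>2" for a b
    unfolding cmod_power2 by (simp add: power2_eq_square algebra_simps)
  have expand: "(cmod (a + t *\<^sub>R w))\<^sup>2
      = (cmod a)\<^sup>2 + (2 * t * Re (cnj a * w) + t\<^sup>2 * (cmod w)\<^sup>2)" for a w t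
    using norm_add_sq[of a "t *\<^sub>R w"]
    by (simp add: cinner_complex_def power_mult_distrib algebra_simps)
  have par_q: "?q (u + v) + ?q (u - v) = 2 * ?q u + 2 * ?q v" for u v
    by (simp add: add diff par sum_distrib_left flip: sum.distrib)
  have hom_q: "?q (a *\<^sub>R u) = a\<^sup>2 * ?q u" for a u
    by (simp add: scale power_mult_distrib sum_distrib_left)
  have nonneg_q: "0 \<le> ?q u" for u
    by (simp add: sum_nonneg)
  define Q where "Q = Inf (?q ` C)"
  have Q: "Q \<le> ?q c" if "c \<in> C" for c
    unfolding Q_def using that by (intro cInf_lower bdd_belowI2[where m = 0] sum_nonneg) auto
  have "m \<le> Q"
    unfolding Q_def using C(2) m by (intro cInf_greatest) auto
  have "\<exists>X. (\<forall>n. X n \<in> C) \<and> (\<lambda>n. ?q (X n)) \<longlonglongrightarrow> Inf (?q ` C) \<and>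
      (\<forall>e>0. \<exists>M. \<forall>m\<ge>M. \<forall>n\<ge>M. ?q (X m - X n) < e)"
    by (rule minimising_sequence[OF par_q hom_q nonneg_q C])
  then obtain X where X: "\<And>n. X n \<in> C" "(\<lambda>n. ?q (X n)) \<longlonglongrightarrow> Q"
    "\<And>e. e > 0 \<Longrightarrow> \<exists>M. \<forall>m\<ge>M. \<forall>n\<ge>M. ?q (X m - X n) < e"
    unfolding Q_def by blast
  have "\<exists>z. (\<lambda>n. s i (X n)) \<longlonglongrightarrow> z" if "i \<in> I" for i
  proof -
    have "Cauchy (\<lambda>n. s i (X n))"
    proof (rule CauchyI)
      fix e :: real
      assume "0 < e"
      then obtain M where M: "\<And>m n. m \<ge> M \<Longrightarrow> n \<ge> M \<Longrightarrow> ?q (X m - X n) < e\<^sup>2"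
        using X(3)[of "e\<^sup>2"] by auto
      have "cmod (s i (X m) - s i (X n)) < e" if "m \<ge> M" "n \<ge> M" for m n
      proof -
        have "(cmod (s i (X m - X n)))\<^sup>2 \<le> ?q (X m - X n)"
          using \<open>finite I\<close> \<open>i \<in> I\<close> by (intro member_le_sum) auto
        also have "\<dots> < e\<^sup>2"
          using M that by blast
        finally show ?thesis
          using \<open>0 < e\<close> by (simp add: diff power2_less_imp_less)
      qed
      then show "\<exists>M. \<forall>m\<ge>M. \<forall>n\<ge>M. cmod (s i (X m) - s i (X n)) < e"
        by blast
    qed
    then show ?thesis
      using Cauchy_convergent_iff convergent_def by blast
  qed
  then obtain z where z: "\<And>i. i \<in> I \<Longrightarrow> (\<lambda>n. s i (X n)) \<longlonglongrightarrow> z i"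
    by metis
  have "(\<lambda>n. ?q (X n)) \<longlonglongrightarrow> (\<Sum>i\<in>I. (cmod (z i))\<^sup>2)"
    by (intro tendsto_intros z)
  then have zQ: "(\<Sum>i\<in>I. (cmod (z i))\<^sup>2) = Q"
    using X(2) LIMSEQ_unique by blast
  show ?thesis
  proof (rule that[of "\<lambda>i. cnj (z i)"])
    fix c
    assume "c \<in> C"
    have "0 \<le> (\<Sum>i\<in>I. Re (cnj (z i) * (s i c - z i)))"
    proof (rule quadratic_nonneg_imp_linear_nonneg)
      fix t :: real
      assume t: "0 < t" "t \<le> 1"
      have "Q \<le> (\<Sum>i\<in>I. (cmod (s i (X n) + t *\<^sub>R (s i c - s i (X n))))\<^sup>2)" for n
      proof -
        have "X n + t *\<^sub>R (c - X n) \<in> C"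
          using convexD_alt[OF C(1) X(1) \<open>c \<in> C\<close>, of t n] t by (simp add: algebra_simps)
        from Q[OF this] show ?thesis
          by (simp add: add scale diff)
      qed
      moreover have "(\<lambda>n. \<Sum>i\<in>I. (cmod (s i (X n) + t *\<^sub>R (s i c - s i (X n))))\<^sup>2)
          \<longlonglongrightarrow> (\<Sum>i\<in>I. (cmod (z i + t *\<^sub>R (s i c - z i)))\<^sup>2)"
        by (intro tendsto_intros z)
      ultimately have "Q \<le> (\<Sum>i\<in>I. (cmod (z i + t *\<^sub>R (s i c - z i)))\<^sup>2)"
        by (intro LIMSEQ_le_const) auto
      also have "\<dots> = (\<Sum>i\<in>I. (cmod (z i))\<^sup>2 + (2 * t * Re (cnj (z i) * (s i c - z i))
          + t\<^sup>2 * (cmod (s i c - z i))\<^sup>2))"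
        by (intro sum.cong refl expand)
      also have "\<dots> = Q + (2 * t * (\<Sum>i\<in>I. Re (cnj (z i) * (s i c - z i)))
          + t\<^sup>2 * (\<Sum>i\<in>I. (cmod (s i c - z i))\<^sup>2))"
        by (simp only: sum.distrib zQ sum_distrib_left)
      finally show "0 \<le> 2 * t * (\<Sum>i\<in>I. Re (cnj (z i) * (s i c - z i)))
          + t\<^sup>2 * (\<Sum>i\<in>I. (cmod (s i c - z i))\<^sup>2)"
        by simp
    qed
    also have "\<dots> = Re (\<Sum>i\<in>I. cnj (z i) * s i c) - (\<Sum>i\<in>I. Re (cnj (z i) * z i))"
      by (simp only: Re_sum right_diff_distrib sum_subtractf minus_complex.simps)
    also have "(\<Sum>i\<in>I. Re (cnj (z i) * z i)) = Q"
      unfolding zQ[symmetric] cmod_power2 by (intro sum.cong refl) (simp add: power2_eq_square)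
    finally show "m \<le> Re (\<Sum>i\<in>I. cnj (z i) * s i c)"
      using \<open>m \<le> Q\<close> by simp
  qed
qed

text \<open>The duality formula for the distance, with the norming functional already of finite rank.
  The ball of radius \<open>r\<close> around \<open>A\<close> is separated from the subspace; a functional whose real part
  has a positive lower bound on \<open>A - S - J\<close> for all \<open>S\<close> of norm at most \<open>r\<close> vanishes on \<open>J\<close>, and
  its norm is then controlled by its value at \<open>A\<close>.\<close>

lemma distance_functional:
  fixes A :: "'h::complex_hilbert \<Rightarrow>\<^sub>L 'h"
  assumes J: "op_subspace J" "closedin weak_operator_topology J"
    and A: "A \<in> bounded_ops" and r: "0 < r" "r < infdist A J"
  obtains P k l where "finite P" and "0 \<le> k" and "k < 1"
    and "\<forall>B\<in>J. (\<Sum>p\<in>P. l p * matrix_entry B p) = 0"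
    and "Re (\<Sum>p\<in>P. l p * matrix_entry A p) = r"
    and "\<forall>S\<in>bounded_ops. cmod (\<Sum>p\<in>P. l p * matrix_entry S p) \<le> k * norm S"
proof -
  have "A - S \<notin> J" if "norm S \<le> r" for S
  proof
    assume "A - S \<in> J"
    then have "infdist A J \<le> norm S"
      using infdist_le[of "A - S" J A] by (simp add: dist_norm)
    then show False
      using that r(2) by simp
  qed
  then obtain P \<delta> where P: "finite P" "\<delta> > 0" "\<And>S B. S \<in> bounded_ops \<Longrightarrow> norm S \<le> r \<Longrightarrow> B \<in> J \<Longrightarrow>
      \<exists>p\<in>P. \<delta> \<le> cmod (matrix_entry (A - S - B) p)"
    using finitely_many_entries_separate[OF J(2) A, of r] r(1) by (metis less_imp_le)
  define K where "K = {S \<in> bounded_ops. norm (S :: 'h \<Rightarrow>\<^sub>L 'h) \<le> r}"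
  define C where "C = {A - S - B | S B. S \<in> K \<and> B \<in> J}"
  have "0 \<in> K" "0 \<in> J"
    using r(1) op_subspace_bounded_ops J(1) by (auto simp: op_subspace_def K_def)
  have "convex K"
  proof -
    have "K = bounded_ops \<inter> cball 0 r"
      by (auto simp: K_def)
    then show ?thesis
      by (simp add: convex_Int subspace_imp_convex op_subspace_imp_subspace op_subspace_bounded_ops)
  qed
  moreover have "convex J"
    using J(1) by (simp add: subspace_imp_convex op_subspace_imp_subspace)
  ultimately have "convex (\<Union>S\<in>K. \<Union>B\<in>J. {S + B})"
    by (rule convex_sums)
  then have "convex ((\<lambda>T. A + (-1) *\<^sub>R T) ` (\<Union>S\<in>K. \<Union>B\<in>J. {S + B}))"
    by (rule convex_affinity)
  also have "(\<lambda>T. A + (-1) *\<^sub>R T) ` (\<Union>S\<in>K. \<Union>B\<in>J. {S + B}) = C"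
    by (force simp: C_def algebra_simps)
  finally have "convex C" .
  moreover have "C \<noteq> {}"
    using \<open>0 \<in> K\<close> \<open>0 \<in> J\<close> by (auto simp: C_def)
  moreover have "\<delta>\<^sup>2 \<le> (\<Sum>p\<in>P. (cmod (matrix_entry c p))\<^sup>2)" if c: "c \<in> C" for c
  proof -
    obtain S B where "c = A - S - B" "S \<in> K" "B \<in> J"
      using c unfolding C_def by blast
    then obtain p where p: "p \<in> P" "\<delta> \<le> cmod (matrix_entry c p)"
      using P(3)[of S B] unfolding K_def by blast
    then have "\<delta>\<^sup>2 \<le> (cmod (matrix_entry c p))\<^sup>2"
      using P(2) by (intro power_mono) auto
    also have "\<dots> \<le> (\<Sum>p\<in>P. (cmod (matrix_entry c p))\<^sup>2)"
      using p(1) P(1) by (intro member_le_sum) auto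
    finally show ?thesis .
  qed
  ultimately obtain l where l: "\<And>c. c \<in> C \<Longrightarrow> \<delta>\<^sup>2 \<le> Re (\<Sum>p\<in>P. l p * matrix_entry c p)"
    using finite_dimensional_separation[OF P(1), of "\<lambda>p S. matrix_entry S p" C "\<delta>\<^sup>2"]
    by (auto simp: matrix_entry_add matrix_entry_scaleR)
  define \<phi> where "\<phi> S = (\<Sum>p\<in>P. l p * matrix_entry S p)" for S
  have \<phi>_diff: "\<phi> (S - T) = \<phi> S - \<phi> T" for S T
    by (simp add: \<phi>_def matrix_entry_diff right_diff_distrib sum_subtractf)
  have \<phi>_scale: "\<phi> (scale_op c S) = c * \<phi> S" for c S
    by (simp add: \<phi>_def matrix_entry_scale_op sum_distrib_left mult_ac)
  have sep: "\<delta>\<^sup>2 \<le> Re (\<phi> A) - Re (\<phi> S) - Re (\<phi> B)" if "S \<in> K" "B \<in> J" for S B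
  proof -
    have "\<delta>\<^sup>2 \<le> Re (\<phi> (A - S - B))"
      unfolding \<phi>_def using that by (intro l) (auto simp: C_def)
    then show ?thesis
      by (simp add: \<phi>_diff)
  qed
  define a where "a = Re (\<phi> A)"
  define m where "m = \<delta>\<^sup>2"
  have \<phi>0: "\<phi> 0 = 0"
    using \<phi>_diff[of 0 0] by simp
  have "0 < m" "m \<le> a"
    using P(2) sep[OF \<open>0 \<in> K\<close> \<open>0 \<in> J\<close>] by (auto simp: m_def a_def \<phi>0)
  have \<phi>J: "\<phi> B = 0" if "B \<in> J" for B
  proof (rule ccontr)
    assume "\<phi> B \<noteq> 0"
    \<comment> \<open>On this multiple of \<open>B\<close> the functional takes the value \<open>a\<close>, which cancels \<open>Re (\<phi> A)\<close>.\<close>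
    have "scale_op (complex_of_real a / \<phi> B) B \<in> J"
      using J(1) that by (simp add: op_subspace_def)
    from sep[OF \<open>0 \<in> K\<close> this] show False
      using \<open>\<phi> B \<noteq> 0\<close> \<open>0 < m\<close> by (simp add: \<phi>_scale \<phi>0 a_def m_def)
  qed
  have bound: "r * cmod (\<phi> S) \<le> (a - m) * norm S" if S: "S \<in> bounded_ops" for S
  proof (cases "S = 0")
    case False
    \<comment> \<open>Multiplication by \<open>c\<close> brings \<open>S\<close> to norm at most \<open>r\<close> and its value to the positive axis.\<close>
    define c where "c = complex_of_real (r / norm S) * cnj (sgn (\<phi> S))"
    have "cmod c \<le> r / norm S"
      using r(1) by (cases "\<phi> S = 0") (simp_all add: c_def norm_mult norm_divide norm_sgn)
    then have "norm (scale_op c S) \<le> r"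
      using order_trans[OF norm_scale_op_le[of c S] mult_right_mono[of "cmod c" "r / norm S" "norm S"]]
        False by simp
    moreover have "scale_op c S \<in> bounded_ops"
      using S by (simp add: bounded_ops_def scale_op_apply scaleC_scaleC mult.commute)
    ultimately have "scale_op c S \<in> K"
      by (simp add: K_def)
    from sep[OF this \<open>0 \<in> J\<close>] have "m \<le> a - Re (c * \<phi> S)"
      by (simp add: \<phi>_scale \<phi>0 a_def m_def)
    moreover have "c * \<phi> S = complex_of_real (r / norm S * cmod (\<phi> S))"
    proof (cases "\<phi> S = 0")
      case False
      have "cnj (sgn (\<phi> S)) * \<phi> S = complex_of_real (cmod (\<phi> S))"
        using complex_norm_square[of "\<phi> S", symmetric] False
        by (simp add: sgn_eq divide_eq_eq mult.commute power2_eq_square)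
      then show ?thesis
        by (simp add: c_def mult.assoc)
    qed simp
    ultimately have "r / norm S * cmod (\<phi> S) \<le> a - m"
      by simp
    then show ?thesis
      using False by (simp add: field_simps)
  qed (simp add: \<phi>0)
  define k where "k = (a - m) / a"
  have a: "a > 0"
    using \<open>0 < m\<close> \<open>m \<le> a\<close> by simp
  have scaled: "(\<Sum>p\<in>P. (complex_of_real (r / a) * l p) * matrix_entry S p) = complex_of_real (r / a) * \<phi> S"
    for S
    by (simp add: \<phi>_def sum_distrib_left mult.assoc)
  \<comment> \<open>Rescaling the functional so that its value at \<open>A\<close> has real part \<open>r\<close> turns the bound
    \<open>(a - m) / r\<close> on its norm into \<open>(a - m) / a < 1\<close>.\<close>
  show ?thesis
  proof (rule that[of P k "\<lambda>p. complex_of_real (r / a) * l p"])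
    show "0 \<le> k" "k < 1"
      using a \<open>0 < m\<close> \<open>m \<le> a\<close> by (auto simp: k_def)
    show "Re (\<Sum>p\<in>P. (complex_of_real (r / a) * l p) * matrix_entry A p) = r"
      unfolding scaled using a by (simp add: a_def)
    show "\<forall>S\<in>bounded_ops.
        cmod (\<Sum>p\<in>P. (complex_of_real (r / a) * l p) * matrix_entry S p) \<le> k * norm S"
    proof
      fix S :: "'h \<Rightarrow>\<^sub>L 'h"
      assume "S \<in> bounded_ops"
      from bound[OF this]
      show "cmod (\<Sum>p\<in>P. (complex_of_real (r / a) * l p) * matrix_entry S p) \<le> k * norm S"
        unfolding scaled norm_mult k_def using a r(1) by (simp add: norm_divide field_simps)
    qed
  qed (unfold scaled, use P(1) \<phi>J in simp_all)
qed


section \<open>Cyclic subspaces and compressions\<close>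

lemma closed_ominus_ideal:
  fixes L :: "'h::complex_hilbert set"
  assumes "closed L"
  shows "closed (ominus_ideal L \<JJ>)"
proof -
  have "ominus_ideal L \<JJ> = L \<inter> (\<Inter>B\<in>\<JJ>. \<Inter>x\<in>L. {v. cinner v (blinfun_apply B x) = 0})"
    by (auto simp: ominus_ideal_def)
  moreover have "closed {v. cinner v (blinfun_apply B x) = 0}" for B :: "'h \<Rightarrow>\<^sub>L 'h" and x
    by (intro closed_Collect_eq cinner.continuous_on continuous_intros)
  ultimately show ?thesis
    using assms by (simp add: closed_Int closed_INT)
qed

lemma complex_subspace_ominus_ideal:
  assumes "complex_subspace L"
  shows "complex_subspace (ominus_ideal L \<JJ>)"
  using assms
  by (auto simp: complex_subspace_def ominus_ideal_def cinner_add_left cinner_scaleC_left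
      cinner.zero_left)

lemma CycLat_invariant:
  assumes "dual_algebra \<AA>" "L \<in> CycLat \<AA>"
  shows "closed L" "complex_subspace L" "A \<in> \<AA> \<Longrightarrow> x \<in> L \<Longrightarrow> blinfun_apply A x \<in> L"
proof -
  obtain h where L: "L = closure {blinfun_apply A h | A. A \<in> \<AA>}"
    using assms(2) by (auto simp: CycLat_def)
  have \<AA>: "op_subspace \<AA>" "\<And>A B. A \<in> \<AA> \<Longrightarrow> B \<in> \<AA> \<Longrightarrow> A o\<^sub>L B \<in> \<AA>"
    using assms(1) by (auto simp: dual_algebra_def)
  show "closed L"
    by (simp add: L)
  have "complex_subspace {blinfun_apply A h | A. A \<in> \<AA>}"
    unfolding complex_subspace_def
  proof (intro conjI ballI allI)
    show "0 \<in> {blinfun_apply A h | A. A \<in> \<AA>}"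
      using \<AA>(1) by (auto simp: op_subspace_def intro!: exI[of _ 0])
  next
    fix x y
    assume "x \<in> {blinfun_apply A h | A. A \<in> \<AA>}" "y \<in> {blinfun_apply A h | A. A \<in> \<AA>}"
    then obtain S T where "S \<in> \<AA>" "T \<in> \<AA>" "x = blinfun_apply S h" "y = blinfun_apply T h"
      by blast
    then show "x + y \<in> {blinfun_apply A h | A. A \<in> \<AA>}"
      using \<AA>(1) by (auto simp: op_subspace_def blinfun.add_left intro!: exI[of _ "S + T"])
  next
    fix c x
    assume "x \<in> {blinfun_apply A h | A. A \<in> \<AA>}"
    then obtain S where "S \<in> \<AA>" "x = blinfun_apply S h"
      by blast
    then show "c *\<^sub>C x \<in> {blinfun_apply A h | A. A \<in> \<AA>}"
      using \<AA>(1) by (auto simp: op_subspace_def scale_op_apply intro!: exI[of _ "scale_op c S"])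
  qed
  then show "complex_subspace L"
    unfolding L by (rule complex_subspace_closure)
  show "blinfun_apply A x \<in> L" if "A \<in> \<AA>" "x \<in> L"
  proof -
    have "blinfun_apply A ` closure {blinfun_apply T h | T. T \<in> \<AA>} \<subseteq> L"
    proof (rule image_closure_subset)
      show "blinfun_apply A ` {blinfun_apply T h | T. T \<in> \<AA>} \<subseteq> L"
      proof
        fix z
        assume "z \<in> blinfun_apply A ` {blinfun_apply T h | T. T \<in> \<AA>}"
        then obtain T where "T \<in> \<AA>" "z = blinfun_apply (A o\<^sub>L T) h"
          by auto
        then show "z \<in> L"
          unfolding L using \<AA>(2)[OF \<open>A \<in> \<AA>\<close> \<open>T \<in> \<AA>\<close>]
          by (intro subsetD[OF closure_subset]) blast
      qed
    qed (auto simp: L intro!: continuous_intros)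
    then show ?thesis
      using that L by blast
  qed
qed

text \<open>The projected vector lies in \<open>L\<close>, so every element of \<open>\<JJ>\<close> maps it to a vector orthogonal
  to \<open>u\<close>. Hence \<open>A\<close> may be replaced by \<open>A - B\<close> with \<open>B \<in> \<JJ>\<close> in the pairing that computes
  the norm.\<close>

lemma compression_norm_le_infdist:
  assumes A: "A \<in> bounded_ops" and "op_subspace \<JJ>" and L: "closed L" "complex_subspace L"
    and u: "u \<in> ominus_ideal L \<JJ>"
  shows "norm (ortho_proj (ominus_ideal L \<JJ>) (blinfun_apply (adj_op A) u)) \<le> infdist A \<JJ> * norm u"
proof -
  let ?N = "ominus_ideal L \<JJ>"
  note N = closed_ominus_ideal[OF L(1), of \<JJ>] complex_subspace_ominus_ideal[OF L(2), of \<JJ>]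
  define w where "w = ortho_proj ?N (blinfun_apply (adj_op A) u)"
  have w: "w \<in> ?N"
    unfolding w_def by (rule ortho_proj(1)[OF N])
  have bound: "norm w \<le> dist A B * norm u" if "B \<in> \<JJ>" for B
  proof (rule norm_le_by_cinner)
    have "cinner (blinfun_apply (adj_op A) u - w) w = 0"
      unfolding w_def using ortho_proj(2)[OF N] w unfolding w_def by blast
    then have "cinner w w = cinner (blinfun_apply (adj_op A) u) w"
      by (simp add: cinner.diff_left)
    also have "\<dots> = cinner u (blinfun_apply A w)"
      using cinner_adj_op[OF A, of w u] by (metis cinner_commute)
    also have "\<dots> = cinner u (blinfun_apply (A - B) w)"
      using u w that by (simp add: ominus_ideal_def blinfun.diff_left cinner.diff_right)
    finally have "cmod (cinner w w) = cmod (cinner (blinfun_apply (A - B) w) u)"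
      by (metis cinner_commute complex_mod_cnj)
    also have "\<dots> \<le> dist A B * norm u * norm w"
      using cmod_cinner_apply_le[of "A - B" w u] by (simp add: dist_norm mult_ac)
    finally show "cmod (cinner w w) \<le> dist A B * norm u * norm w" .
  qed simp
  show ?thesis
  proof (cases "u = 0")
    case True
    have "0 \<in> \<JJ>"
      using assms(2) by (simp add: op_subspace_def)
    then show ?thesis
      using bound[of 0] True unfolding w_def by simp
  next
    case False
    have "\<JJ> \<noteq> {}"
      using assms(2) by (auto simp: op_subspace_def)
    then have "norm w / norm u \<le> (INF B\<in>\<JJ>. dist A B)"
      using bound False by (intro cINF_greatest) (simp_all add: divide_le_eq)
    then have "norm w / norm u \<le> infdist A \<JJ>"
      using \<open>\<JJ> \<noteq> {}\<close> by (simp add: infdist_notempty)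
    then show ?thesis
      using False by (simp add: divide_le_eq w_def)
  qed
qed

text \<open>For an invariant subspace \<open>L\<close> the part \<open>L \<ominus> \<JJ>L\<close> is invariant under the compression of
  \<open>A\<^sup>*\<close> to \<open>L\<close>, because \<open>\<JJ>L\<close> is invariant under \<open>A\<close>.\<close>

lemma compression_eq_compression_to_ominus_ideal:
  assumes A: "A \<in> bounded_ops" and L: "closed L" "complex_subspace L"
    and ideal: "\<And>B. B \<in> \<JJ> \<Longrightarrow> A o\<^sub>L B \<in> \<JJ>"
    and invariant: "\<And>B x. B \<in> \<JJ> \<Longrightarrow> x \<in> L \<Longrightarrow> blinfun_apply B x \<in> L"
    and v: "v \<in> ominus_ideal L \<JJ>"
  shows "ortho_proj (ominus_ideal L \<JJ>) (blinfun_apply (adj_op A) v)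
    = ortho_proj L (blinfun_apply (adj_op A) v)"
proof (rule ortho_proj_eqI[OF closed_ominus_ideal[OF L(1)] complex_subspace_ominus_ideal[OF L(2)]])
  let ?a = "blinfun_apply (adj_op A) v"
  let ?p = "ortho_proj L ?a"
  have "cinner ?p (blinfun_apply B x) = 0" if "B \<in> \<JJ>" "x \<in> L" for B x
  proof -
    have "cinner ?p (blinfun_apply B x) = cinner ?a (blinfun_apply B x)"
      using ortho_proj(2)[OF L invariant[OF that], of ?a] by (simp add: cinner.diff_left)
    also have "\<dots> = cinner v (blinfun_apply (A o\<^sub>L B) x)"
      using cinner_adj_op[OF A, of "blinfun_apply B x" v]
      by (metis blinfun_apply_blinfun_compose cinner_commute)
    also have "\<dots> = 0"
      using v ideal[OF that(1)] that(2) unfolding ominus_ideal_def by blast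
    finally show ?thesis .
  qed
  then show "?p \<in> ominus_ideal L \<JJ>"
    using ortho_proj(1)[OF L] by (simp add: ominus_ideal_def)
  show "cinner (?a - ?p) z = 0" if "z \<in> ominus_ideal L \<JJ>" for z
    using that ortho_proj(2)[OF L] by (simp add: ominus_ideal_def)
qed

text \<open>The vector \<open>y\<close> can be replaced by its projection to the cyclic subspace of \<open>x\<close>. The ideal
  property turns the vanishing of the functional on \<open>\<JJ>\<close> into orthogonality of that projection
  to \<open>\<JJ>\<AA>x\<close>, whose closure contains \<open>\<JJ>L\<close>.\<close>

lemma vector_functional_via_compression:
  assumes \<AA>: "dual_algebra \<AA>" and \<JJ>: "two_sided_ideal \<JJ> \<AA>" and "A \<in> \<AA>"
    and vanish: "\<And>B. B \<in> \<JJ> \<Longrightarrow> cinner (blinfun_apply B x) y = 0"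
  obtains L v where "L \<in> CycLat \<AA>" and "v \<in> ominus_ideal L \<JJ>" and "norm v \<le> norm y"
    and "cinner (blinfun_apply A x) y
      = cinner x (ortho_proj (ominus_ideal L \<JJ>) (blinfun_apply (adj_op A) v))"
proof -
  define L where "L = closure {blinfun_apply T x | T. T \<in> \<AA>}"
  have "L \<in> CycLat \<AA>"
    by (auto simp: L_def CycLat_def)
  note L = CycLat_invariant[OF \<AA> this]
  have "\<AA> \<subseteq> bounded_ops" "id_blinfun \<in> \<AA>" "\<JJ> \<subseteq> \<AA>"
    using \<AA> \<JJ> by (auto simp: dual_algebra_def op_subspace_def two_sided_ideal_def)
  then have A: "A \<in> bounded_ops"
    using \<open>A \<in> \<AA>\<close> by blast
  have "x \<in> {blinfun_apply T x | T. T \<in> \<AA>}"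
    using \<open>id_blinfun \<in> \<AA>\<close> by (auto intro!: exI[of _ id_blinfun])
  then have "x \<in> L"
    unfolding L_def by (rule subsetD[OF closure_subset])
  define v where "v = ortho_proj L y"
  have v: "v \<in> L" "\<And>z. z \<in> L \<Longrightarrow> cinner z y = cinner z v"
  proof -
    show "v \<in> L"
      unfolding v_def by (rule ortho_proj(1)[OF L(1,2)])
    show "cinner z y = cinner z v" if "z \<in> L" for z
    proof -
      have "cinner y z = cinner v z"
        using ortho_proj(2)[OF L(1,2) that, of y] by (simp add: v_def cinner.diff_left)
      then show ?thesis
        by (metis cinner_commute)
    qed
  qed
  have "cinner v (blinfun_apply B z) = 0" if B: "B \<in> \<JJ>" and "z \<in> L" for B z
  proof -
    have "{blinfun_apply T x | T. T \<in> \<AA>} \<subseteq> {z. cinner (blinfun_apply B z) y = 0}"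
    proof
      fix z
      assume "z \<in> {blinfun_apply T x | T. T \<in> \<AA>}"
      then obtain T where "T \<in> \<AA>" "z = blinfun_apply T x"
        by blast
      moreover have "B o\<^sub>L T \<in> \<JJ>"
        using \<JJ> B \<open>T \<in> \<AA>\<close> by (simp add: two_sided_ideal_def)
      ultimately show "z \<in> {z. cinner (blinfun_apply B z) y = 0}"
        using vanish[of "B o\<^sub>L T"] by simp
    qed
    moreover have "closed {z. cinner (blinfun_apply B z) y = 0}"
      by (intro closed_Collect_eq cinner.continuous_on continuous_intros)
    ultimately have "L \<subseteq> {z. cinner (blinfun_apply B z) y = 0}"
      unfolding L_def by (rule closure_minimal)
    then have "cinner (blinfun_apply B z) y = 0"
      using \<open>z \<in> L\<close> by blast
    moreover have "blinfun_apply B z \<in> L"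
      using L(3) B \<open>z \<in> L\<close> \<open>\<JJ> \<subseteq> \<AA>\<close> by blast
    ultimately have "cinner (blinfun_apply B z) v = 0"
      using v(2) by simp
    then show ?thesis
      by (metis cinner_commute complex_cnj_zero)
  qed
  then have vN: "v \<in> ominus_ideal L \<JJ>"
    using v(1) by (simp add: ominus_ideal_def)
  let ?a = "blinfun_apply (adj_op A) v"
  have "cinner (blinfun_apply A x) y = cinner x ?a"
    using v(2)[OF L(3)[OF \<open>A \<in> \<AA>\<close> \<open>x \<in> L\<close>]] cinner_adj_op[OF A] by simp
  also have "\<dots> = cinner x (ortho_proj L ?a)"
  proof -
    have "cinner ?a x = cinner (ortho_proj L ?a) x"
      using ortho_proj(2)[OF L(1,2) \<open>x \<in> L\<close>, of ?a] by (simp add: cinner.diff_left)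
    then show ?thesis
      by (metis cinner_commute)
  qed
  also have "ortho_proj L ?a = ortho_proj (ominus_ideal L \<JJ>) ?a"
  proof (rule compression_eq_compression_to_ominus_ideal[OF A L(1,2) _ _ vN, symmetric])
    show "A o\<^sub>L B \<in> \<JJ>" if "B \<in> \<JJ>" for B
      using \<JJ> \<open>A \<in> \<AA>\<close> that by (simp add: two_sided_ideal_def)
    show "blinfun_apply B z \<in> L" if "B \<in> \<JJ>" "z \<in> L" for B z
      using L(3) \<open>\<JJ> \<subseteq> \<AA>\<close> that by blast
  qed
  finally show ?thesis
    using that[OF \<open>L \<in> CycLat \<AA>\<close> vN] norm_ortho_proj_le[OF L(1,2), of y] by (simp add: v_def)
qed


section \<open>The distance formula\<close>

theorem theorem3p3:
  fixes \<AA> \<JJ> :: "('h::complex_hilbert \<Rightarrow>\<^sub>L 'h) set"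
    and A :: "'h \<Rightarrow>\<^sub>L 'h"
  assumes "dual_algebra \<AA>"
    and "property_A1_1 \<AA>"
    and "two_sided_ideal \<JJ> \<AA>"
    and "closedin weak_operator_topology \<JJ>"
    and "A \<in> \<AA>"
  shows "infdist A \<JJ> =
    (SUP L\<in>CycLat \<AA>. onorm_on (ominus_ideal L \<JJ>)
       (\<lambda>x. ortho_proj (ominus_ideal L \<JJ>) (blinfun_apply (adj_op A) x)))"
proof (rule antisym)
  let ?c = "\<lambda>L x. ortho_proj (ominus_ideal L \<JJ>) (blinfun_apply (adj_op A) x)"
  let ?n = "\<lambda>L. onorm_on (ominus_ideal L \<JJ>) (?c L)"
  have \<AA>: "op_subspace \<AA>" "\<AA> \<subseteq> bounded_ops" and \<JJ>: "op_subspace \<JJ>" "\<JJ> \<subseteq> \<AA>"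
    using assms(1,3) by (auto simp: dual_algebra_def op_subspace_def two_sided_ideal_def)
  then have A: "A \<in> bounded_ops"
    using assms(5) by blast
  note L = CycLat_invariant[OF assms(1)]
  have ratio: "norm (?c L x) / norm x \<le> infdist A \<JJ>" if "L \<in> CycLat \<AA>" "x \<in> ominus_ideal L \<JJ>"
    for L x
    using compression_norm_le_infdist[OF A \<JJ>(1) L(1,2)[OF that(1)] that(2)]
    by (cases "x = 0") (simp_all add: divide_le_eq infdist_nonneg)
  have zero: "0 \<in> ominus_ideal L \<JJ>" if "L \<in> CycLat \<AA>" for L
    using complex_subspace_ominus_ideal[OF L(2)[OF that]] by (simp add: complex_subspace_def)
  have n_le: "?n L \<le> infdist A \<JJ>" if "L \<in> CycLat \<AA>" for L
    unfolding onorm_on_def using ratio zero that by (intro cSUP_least) auto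
  have le_n: "norm (?c L x) \<le> ?n L * norm x" if "L \<in> CycLat \<AA>" "x \<in> ominus_ideal L \<JJ>" for L x
  proof (cases "x = 0")
    case True
    then show ?thesis
      using compression_norm_le_infdist[OF A \<JJ>(1) L(1,2)[OF that(1)] that(2)] by simp
  next
    case False
    have "norm (?c L x) / norm x \<le> ?n L"
      unfolding onorm_on_def using ratio that
      by (intro cSUP_upper bdd_aboveI2[where M = "infdist A \<JJ>"]) auto
    then show ?thesis
      using False by (simp add: divide_le_eq)
  qed
  have "CycLat \<AA> \<noteq> {}"
    by (auto simp: CycLat_def)
  then show "(SUP L\<in>CycLat \<AA>. ?n L) \<le> infdist A \<JJ>"
    using n_le by (intro cSUP_least)
  have n_le_sup: "?n L \<le> (SUP L\<in>CycLat \<AA>. ?n L)" if "L \<in> CycLat \<AA>" for L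
    using n_le that by (intro cSUP_upper bdd_aboveI2)
  have n_nonneg: "0 \<le> ?n L" if "L \<in> CycLat \<AA>" for L
  proof -
    have "norm (?c L 0) / norm (0::'h) \<le> ?n L"
      unfolding onorm_on_def using ratio that zero[OF that]
      by (intro cSUP_upper bdd_aboveI2[where M = "infdist A \<JJ>"]) auto
    then show ?thesis
      by simp
  qed
  show "infdist A \<JJ> \<le> (SUP L\<in>CycLat \<AA>. ?n L)"
  proof (rule dense_le)
    fix r
    assume r: "r < infdist A \<JJ>"
    show "r \<le> (SUP L\<in>CycLat \<AA>. ?n L)"
    proof (cases "0 < r")
      case False
      then show ?thesis
        using \<open>CycLat \<AA> \<noteq> {}\<close> n_nonneg n_le_sup by (meson ex_in_conv not_less order_trans)
    next
      case True
      obtain P k l where P: "finite P" "0 \<le> k" "k < 1"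
        and vanish: "\<forall>B\<in>\<JJ>. (\<Sum>p\<in>P. l p * matrix_entry B p) = 0"
        and value_A: "Re (\<Sum>p\<in>P. l p * matrix_entry A p) = r"
        and bound: "\<forall>S\<in>bounded_ops. cmod (\<Sum>p\<in>P. l p * matrix_entry S p) \<le> k * norm S"
        by (rule distance_functional[OF \<JJ>(1) assms(4) A True r])
      define \<phi> where "\<phi> S = (\<Sum>p\<in>P. l p * matrix_entry S p)" for S :: "'h \<Rightarrow>\<^sub>L 'h"
      have "continuous_map weak_star_topology euclidean \<phi>"
        unfolding \<phi>_def[abs_def] matrix_entry_def
      proof (intro continuous_map_sum P(1))
        fix p
        have "continuous_map weak_star_topology euclidean
            ((\<lambda>z. l p * z) \<circ> (\<lambda>S. cinner (blinfun_apply S (fst p)) (snd p)))"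
          by (rule continuous_map_compose[OF continuous_map_vector_functional])
            (simp add: continuous_on_mult_left)
        then show "continuous_map weak_star_topology euclidean
            (\<lambda>S. l p * cinner (blinfun_apply S (fst p)) (snd p))"
          by (simp add: o_def)
      qed
      then have "weak_star_functional \<AA> \<phi>"
        unfolding weak_star_functional_def
        by (auto simp: \<phi>_def matrix_entry_add matrix_entry_scale_op distrib_left sum.distrib
            sum_distrib_left mult_ac intro: continuous_map_from_subtopology)
      moreover have "onorm_on \<AA> \<phi> < 1"
      proof -
        have "cmod (\<phi> S) / norm S \<le> k" if "S \<in> \<AA>" for S
          using bound that \<AA>(2) P(2)
          by (cases "S = 0") (auto simp: \<phi>_def divide_le_eq)
        then have "onorm_on \<AA> \<phi> \<le> k"
          unfolding onorm_on_def using assms(5) by (intro cSUP_least) auto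
        then show ?thesis
          using P(3) by simp
      qed
      ultimately obtain x y where xy: "norm x * norm y < 1"
        "\<And>S. S \<in> \<AA> \<Longrightarrow> \<phi> S = cinner (blinfun_apply S x) y"
        using assms(2) unfolding property_A1_1_def by blast
      have "cinner (blinfun_apply B x) y = 0" if "B \<in> \<JJ>" for B
        using vanish xy(2)[of B] that \<JJ>(2) by (auto simp: \<phi>_def)
      then obtain M v where M: "M \<in> CycLat \<AA>" "v \<in> ominus_ideal M \<JJ>" "norm v \<le> norm y"
        "cinner (blinfun_apply A x) y = cinner x (?c M v)"
        by (rule vector_functional_via_compression[OF assms(1,3,5)])
      have "r \<le> cmod (\<phi> A)"
        using value_A complex_Re_le_cmod[of "\<phi> A"] by (simp add: \<phi>_def)
      also have "\<dots> = cmod (cinner x (?c M v))"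
        using xy(2)[OF assms(5)] M(4) by simp
      also have "\<dots> \<le> norm x * norm (?c M v)"
        by (rule cauchy_schwarz)
      also have "\<dots> \<le> norm x * (?n M * norm y)"
        using le_n[OF M(1,2)] mult_left_mono[OF M(3) n_nonneg[OF M(1)]]
        by (intro mult_left_mono) auto
      also have "\<dots> = ?n M * (norm x * norm y)"
        by simp
      also have "\<dots> \<le> ?n M"
        using xy(1) n_nonneg[OF M(1)] by (intro mult_left_le) auto
      also have "\<dots> \<le> (SUP L\<in>CycLat \<AA>. ?n L)"
        by (rule n_le_sup[OF M(1)])
      finally show ?thesis .
    qed
  qed
qed

end
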